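(* Let $k\ge 4$ be an integer and let $G=(V,E)$ be a simple undirected graph. Let $\mathcal S$ be the $k^-$-star partition returned by Algorithm Approx1 on $G$, and let $\mathrm{OPT}$ be the minimum number of stars in a $k^-$-star partition of $G$. Then $$|\mathcal S|\le \frac{2k^2-4k+1}{4k-7}\,\mathrm{OPT}\;=\;\Bigl(\frac k2-\frac{k-2}{8k-14}\Bigr)\mathrm{OPT}.$$
   Context: A star in $G$ is a subgraph of $G$ that is either a single vertex, a single edge, or a tree in which exactly one vertex has degree at least $2$ and all other vertices have degree $1$. An $\ell$-star is a star with exactly $\ell$ vertices; an $\ell^+$-star (resp. $\ell^-$-star) has at least (resp. at most) $\ell$ vertices. The center of a star is its vertex of maximum degree; in a $2$-star one of the two vertices is designated (arbitrarily but fixed) as the center; the other vertices are satellites. We write $v_1$-$v_2\ldots v_\ell$ for the $\ell$-star with center $v_1$ and satellites $v_2,\dots,v_\ell$. A $k^-$-star partition of $G$ is a collection of vertex-disjoint $k^-$-stars in $G$ whose vertex sets cover $V$; the $k^-$-star partition problem asks for one with the minimum number of stars. For a $k^-$-star partition $\mathcal S$, $\mathcal S_j$ is its set of $j$-stars. Given the current partition $\mathcal S$: a vertex is critical if it lies in a $2$-star of $\mathcal S$ or is the center of a $3$-star of $\mathcal S$; two critical vertices are separate if they lie in different stars of $\mathcal S$. The $2$- and $3$-stars of $\mathcal S$ are called tiny. Operation 1: if $\{u,v\}\in E$ where $u$ lies in a $2$-star of $\mathcal S$ and $v$ is a satellite of a $4^+$-star of $\mathcal S$ with center $c$, replace the edge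 $\{c,v\}$ by $\{u,v\}$ (so $u$'s star becomes a $3$-star centered at $u$). Operation 2: if $S=v_1$-$v_2\ldots v_\ell$ is a star of $\mathcal S$ with $\ell\in\{2,3,4\}$ and there are $\ell$ pairwise separate critical vertices $w_1,\dots,w_\ell\notin V(S)$ with $\{v_j,w_j\}\in E$ for all $j$, delete the edges of $S$ and add the edges $\{v_j,w_j\}$, $j=1,\dots,\ell$ (each $w_j$ becomes the center of its enlarged star). Operation 3: let $S=v_1$-$v_2\ldots v_\ell$ be a tiny star of $\mathcal S$ and $W=w_1$-$w_2$ a $2$-star of $\mathcal S$, $W\neq S$, with $w_1,w_2$ both adjacent to $v_1$ in $G$. If $k\ge5$ or $\ell=2$, replace the edge $\{w_1,w_2\}$ by $\{w_1,v_1\},\{w_2,v_1\}$. Otherwise ($k=4$, $\ell=3$), if there is a critical vertex $w_3\notin V(S)\cup V(W)$ adjacent to $v_j$ for some $j\in\{2,3\}$, replace the edges $\{w_1,w_2\},\{v_1,v_j\}$ by $\{w_1,v_1\},\{w_2,v_1\},\{w_3,v_j\}$. Algorithm Approx1: compute a $k^-$-star partition $\mathcal S$ of $G$ having the minimum possible number of $1$-stars among all $k^-$-star partitions; then, while one of Operations 1–3 is applicable to $\mathcal S$, apply it; return $\mathcal S$.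
   Formalization: In Operation 3 either endpoint of a 2-star may serve as its center, instead of one fixed designated endpoint; with a fixed one the bound fails (k=4: edges cx, cw1, cw2, w1w2, stars x-c with center x and w1-w2, so 2 stars against OPT=1). Graphs are finite. *)

theory Defs
  imports Complex_Main
begin

record 'a graph =
  verts :: "'a set"
  edges :: "'a set set"

definition simple_graph :: "'a graph \<Rightarrow> bool" where
  "simple_graph G \<longleftrightarrow> finite (verts G) \<and>
     (\<forall>e\<in>edges G. \<exists>u\<in>verts G. \<exists>v\<in>verts G. u \<noteq> v \<and> e = {u, v})"

definition subgraph :: "'a graph \<Rightarrow> 'a graph \<Rightarrow> bool" where
  "subgraph H G \<longleftrightarrow> verts H \<subseteq> verts G \<and> edges H \<subseteq> edges G \<and> (\<forall>e\<in>edges H. e \<subseteq> verts H)"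

definition degree :: "'a graph \<Rightarrow> 'a \<Rightarrow> nat" where
  "degree H v = card {e \<in> edges H. v \<in> e}"

definition connected_graph :: "'a graph \<Rightarrow> bool" where
  "connected_graph H \<longleftrightarrow> verts H \<noteq> {} \<and>
     (\<forall>u\<in>verts H. \<forall>v\<in>verts H. (u, v) \<in> {(x, y). {x, y} \<in> edges H}\<^sup>*)"

definition is_cycle :: "'a graph \<Rightarrow> 'a list \<Rightarrow> bool" where
  "is_cycle H vs \<longleftrightarrow> length vs \<ge> 3 \<and> distinct vs \<and>
     (\<forall>i<length vs. {vs ! i, vs ! (Suc i mod length vs)} \<in> edges H)"

definition is_tree :: "'a graph \<Rightarrow> bool" where
  "is_tree H \<longleftrightarrow> connected_graph H \<and> (\<nexists>vs. is_cycle H vs)"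

definition is_star :: "'a graph \<Rightarrow> bool" where
  "is_star H \<longleftrightarrow>
     (\<exists>v. verts H = {v} \<and> edges H = {}) \<or>
     (\<exists>u v. u \<noteq> v \<and> verts H = {u, v} \<and> edges H = {{u, v}}) \<or>
     (is_tree H \<and> (\<exists>c\<in>verts H. degree H c \<ge> 2 \<and> (\<forall>v\<in>verts H - {c}. degree H v = 1)))"

definition star_in :: "'a graph \<Rightarrow> 'a graph \<Rightarrow> bool" where
  "star_in G S \<longleftrightarrow> subgraph S G \<and> is_star S"

abbreviation star_size :: "'a graph \<Rightarrow> nat" where
  "star_size S \<equiv> card (verts S)"

text \<open>In a 2-star both endpoints have maximum degree, so both satisfy the following predicate:
  either endpoint may be taken as the center of a 2-star. In all other stars the center is
  unique.\<close>

definition is_center :: "'a graph \<Rightarrow> 'a \<Rightarrow> bool" where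
  "is_center S c \<longleftrightarrow> c \<in> verts S \<and> (\<forall>v\<in>verts S. degree S v \<le> degree S c)"

definition star_partition :: "nat \<Rightarrow> 'a graph \<Rightarrow> 'a graph set \<Rightarrow> bool" where
  "star_partition k G P \<longleftrightarrow>
     (\<forall>S\<in>P. star_in G S \<and> star_size S \<le> k) \<and>
     (\<forall>S\<in>P. \<forall>T\<in>P. S \<noteq> T \<longrightarrow> verts S \<inter> verts T = {}) \<and>
     (\<Union>S\<in>P. verts S) = verts G"

definition opt :: "nat \<Rightarrow> 'a graph \<Rightarrow> nat" where
  "opt k G = (LEAST n. \<exists>P. star_partition k G P \<and> card P = n)"

definition stars_of_size :: "nat \<Rightarrow> 'a graph set \<Rightarrow> 'a graph set" where
  "stars_of_size j P = {S \<in> P. star_size S = j}"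

definition critical :: "'a graph set \<Rightarrow> 'a \<Rightarrow> bool" where
  "critical P x \<longleftrightarrow>
     (\<exists>S\<in>P. star_size S = 2 \<and> x \<in> verts S \<or> star_size S = 3 \<and> is_center S x)"

definition separate :: "'a graph set \<Rightarrow> 'a \<Rightarrow> 'a \<Rightarrow> bool" where
  "separate P x y \<longleftrightarrow> (\<exists>S\<in>P. \<exists>T\<in>P. S \<noteq> T \<and> x \<in> verts S \<and> y \<in> verts T)"

definition attach :: "'a graph \<Rightarrow> 'a \<Rightarrow> 'a \<Rightarrow> 'a graph" where
  "attach S c v = \<lparr>verts = insert v (verts S), edges = insert {c, v} (edges S)\<rparr>"

definition detach :: "'a graph \<Rightarrow> 'a \<Rightarrow> 'a \<Rightarrow> 'a graph" where
  "detach S c v = \<lparr>verts = verts S - {v}, edges = edges S - {{c, v}}\<rparr>"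

text \<open>The relations below hold between a partition \<open>P\<close> and the result \<open>P'\<close> of
  applying the operation to \<open>P\<close> for one admissible choice of stars and vertices.\<close>

definition operation1 :: "'a graph \<Rightarrow> 'a graph set \<Rightarrow> 'a graph set \<Rightarrow> bool" where
  "operation1 G P P' \<longleftrightarrow>
     (\<exists>U\<in>P. \<exists>T\<in>P. \<exists>u c v.
        star_size U = 2 \<and> u \<in> verts U \<and>
        star_size T \<ge> 4 \<and> is_center T c \<and> v \<in> verts T - {c} \<and>
        {u, v} \<in> edges G \<and>
        P' = (P - {U, T}) \<union> {attach U u v, detach T c v})"

text \<open>The vertices \<open>w\<^sub>1, \<dots>, w\<^sub>\<ell>\<close> are given by a function \<open>w\<close> on
  the vertices \<open>v\<^sub>1, \<dots>, v\<^sub>\<ell>\<close> of \<open>S\<close>.\<close>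

definition operation2 :: "'a graph \<Rightarrow> 'a graph set \<Rightarrow> 'a graph set \<Rightarrow> bool" where
  "operation2 G P P' \<longleftrightarrow>
     (\<exists>S\<in>P. \<exists>w.
        star_size S \<in> {2, 3, 4} \<and>
        (\<forall>v\<in>verts S. critical P (w v) \<and> w v \<notin> verts S \<and> {v, w v} \<in> edges G) \<and>
        (\<forall>v\<in>verts S. \<forall>v'\<in>verts S. v \<noteq> v' \<longrightarrow> separate P (w v) (w v')) \<and>
        P' = (P - {S} - {T \<in> P. \<exists>v\<in>verts S. w v \<in> verts T})
             \<union> {attach T (w v) v | T v. T \<in> P \<and> v \<in> verts S \<and> w v \<in> verts T})"

definition operation3 :: "nat \<Rightarrow> 'a graph \<Rightarrow> 'a graph set \<Rightarrow> 'a graph set \<Rightarrow> bool" where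
  "operation3 k G P P' \<longleftrightarrow>
     (\<exists>S\<in>P. \<exists>W\<in>P. \<exists>v\<^sub>1 w\<^sub>1 w\<^sub>2.
        star_size S \<in> {2, 3} \<and> is_center S v\<^sub>1 \<and>
        W \<noteq> S \<and> star_size W = 2 \<and> verts W = {w\<^sub>1, w\<^sub>2} \<and>
        {w\<^sub>1, v\<^sub>1} \<in> edges G \<and> {w\<^sub>2, v\<^sub>1} \<in> edges G \<and>
        (if k \<ge> 5 \<or> star_size S = 2
         then P' = (P - {S, W}) \<union> {attach (attach S v\<^sub>1 w\<^sub>1) v\<^sub>1 w\<^sub>2}
         else \<exists>T\<in>P. \<exists>w\<^sub>3\<in>verts T. \<exists>v\<^sub>j\<in>verts S - {v\<^sub>1}.
           critical P w\<^sub>3 \<and> w\<^sub>3 \<notin> verts S \<union> verts W \<and> {w\<^sub>3, v\<^sub>j} \<in> edges G \<and>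
           P' = (P - {S, W, T})
                \<union> {attach (attach (detach S v\<^sub>1 v\<^sub>j) v\<^sub>1 w\<^sub>1) v\<^sub>1 w\<^sub>2, attach T w\<^sub>3 v\<^sub>j}))"

definition approx1_step :: "nat \<Rightarrow> 'a graph \<Rightarrow> 'a graph set \<Rightarrow> 'a graph set \<Rightarrow> bool" where
  "approx1_step k G P P' \<longleftrightarrow> operation1 G P P' \<or> operation2 G P P' \<or> operation3 k G P P'"

definition min_singletons :: "nat \<Rightarrow> 'a graph \<Rightarrow> 'a graph set \<Rightarrow> bool" where
  "min_singletons k G P \<longleftrightarrow> star_partition k G P \<and>
     (\<forall>Q. star_partition k G Q \<longrightarrow> card (stars_of_size 1 P) \<le> card (stars_of_size 1 Q))"

text \<open>The algorithm is nondeterministic, both in the initial partition and in the operations it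
  applies: \<open>P\<close> is a possible output if some run ends in \<open>P\<close>.\<close>

definition approx1_returns :: "nat \<Rightarrow> 'a graph \<Rightarrow> 'a graph set \<Rightarrow> bool" where
  "approx1_returns k G P \<longleftrightarrow>
     (\<exists>P\<^sub>0. min_singletons k G P\<^sub>0 \<and> (approx1_step k G)\<^sup>*\<^sup>* P\<^sub>0 P) \<and>
     (\<nexists>P'. approx1_step k G P P')"

end

theory Submission
  imports Defs
begin

text \<open>
  A double counting argument. Write \<open>m = 4k - 7\<close>; every vertex of a star of the returned partition
  \<open>P\<close> receives a charge so that a star with \<open>j \<ge> 2\<close> vertices hands out at most \<open>m (j - 2)\<close>. If every star
  \<open>T\<close> of an optimal partition \<open>Q\<close> collects at least \<open>k - 2\<close>, counting a bonus \<open>m\<close> for each vertex it has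
  less than \<open>k\<close>, then summing over both partitions gives the ratio; the singletons of \<open>P\<close> are paid for by
  those of \<open>Q\<close> because \<open>P\<close> has the fewest possible.

  The only stars of \<open>Q\<close> that get nothing directly are those of size \<open>k\<close> consisting of vertices of 2-stars
  of \<open>P\<close>. As Operations 2 and 3 do not apply, at least \<open>k - 2\<close> vertices of such a star have a partner
  outside of it with no other critical neighbour, and each of these partners passes on one unit. A star
  of \<open>Q\<close> can contain \<open>k - 1\<close> such debtors only if its center lies in a larger star of \<open>P\<close> and all
  its satellites are critical; Operation 2 shows that if all vertices but one of a 3- or 4-star of \<open>P\<close> are
  centers of this kind, then the remaining vertex has no critical neighbour outside its star, hence
  it can give up its own share.
\<close>

section \<open>Stars\<close>

text \<open>One formula for stars of every size with a named center, replacing the three cases and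
  the tree condition of \<open>is_star\<close>. For a 2-star it holds at both ends, which matches
  the free choice of center there.\<close>

definition star_at :: "'a graph \<Rightarrow> 'a \<Rightarrow> bool" where
  "star_at H c \<longleftrightarrow> finite (verts H) \<and> c \<in> verts H \<and> edges H = (\<lambda>v. {c, v}) ` (verts H - {c})"

lemma star_at_degree_center:
  assumes "star_at H c"
  shows "degree H c = card (verts H) - 1"
proof -
  have "{e \<in> edges H. c \<in> e} = (\<lambda>v. {c, v}) ` (verts H - {c})"
    using assms by (auto simp: star_at_def)
  moreover have "inj_on (\<lambda>v. {c, v}) (verts H - {c})"
    by (auto simp: inj_on_def doubleton_eq_iff)
  ultimately show ?thesis
    using assms by (simp add: degree_def card_image star_at_def)
qed

lemma star_at_degree_satellite:
  assumes "star_at H c" "v \<in> verts H" "v \<noteq> c"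
  shows "degree H v = 1"
proof -
  have "{e \<in> edges H. v \<in> e} = {{c, v}}"
    using assms by (auto simp: star_at_def)
  then show ?thesis by (simp add: degree_def)
qed

lemma star_at_card_pos: "star_at H c \<Longrightarrow> card (verts H) \<ge> 1"
  by (metis One_nat_def Suc_leI card_gt_0_iff empty_iff star_at_def)

lemma star_at_is_center:
  assumes "star_at H c"
  shows "is_center H c"
proof -
  have "degree H v \<le> degree H c" if "v \<in> verts H" for v
  proof (cases "v = c")
    case False
    have "card {c, v} \<le> card (verts H)"
      using assms that by (intro card_mono) (auto simp: star_at_def)
    then show ?thesis
      using False star_at_degree_satellite[OF assms that False] star_at_degree_center[OF assms] by simp
  qed simp
  then show ?thesis using assms by (auto simp: is_center_def star_at_def)
qed

lemma star_at_small:
  assumes "star_at H c" "card (verts H) \<le> 2" "d \<in> verts H"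
  shows "star_at H d"
proof (cases "d = c")
  case False
  have "{c, d} \<subseteq> verts H" "finite (verts H)" using assms by (auto simp: star_at_def)
  then have "verts H = {c, d}"
    using assms(2) False by (metis card_2_iff card_seteq)
  then show ?thesis using assms False by (auto simp: star_at_def)
qed (use assms in simp)

text \<open>If \<open>d\<close> were a satellite, its degree 1 would be maximal, hence the degree of
  \<open>c\<close>, the number of satellites, would be at most 1. Then there are at most two
  vertices, and each of them can serve as center.\<close>

lemma is_center_star_at:
  assumes "star_at H c" "is_center H d"
  shows "star_at H d"
proof (cases "d = c")
  case False
  have "d \<in> verts H" "degree H c \<le> degree H d"
    using assms by (auto simp: is_center_def star_at_def)
  then have "card (verts H) \<le> 2"
    using star_at_degree_center[OF assms(1)] star_at_degree_satellite[OF assms(1) _ False] by simp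
  then show ?thesis using star_at_small assms(1) \<open>d \<in> verts H\<close> by metis
qed (use assms in simp)

lemma star_at_unique:
  assumes "star_at H c" "star_at H d" "card (verts H) \<ge> 3"
  shows "c = d"
proof (rule ccontr)
  assume "c \<noteq> d"
  then have "degree H d = 1" using star_at_degree_satellite[OF assms(1)] assms(2) by (auto simp: star_at_def)
  then show False using star_at_degree_center[OF assms(2)] assms(3) by simp
qed

text \<open>Every edge contains \<open>c\<close>, whereas on a cycle without repetitions
  \<open>c\<close> lies on only two of the at least three edges.\<close>

lemma star_at_acyclic:
  assumes "star_at H c"
  shows "\<not> is_cycle H vs"
proof
  assume "is_cycle H vs"
  then have len: "length vs \<ge> 3" and dist: "distinct vs"
    and ed: "\<And>i. i < length vs \<Longrightarrow> {vs ! i, vs ! (Suc i mod length vs)} \<in> edges H"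
    by (auto simp: is_cycle_def)
  have c: "vs ! i = c \<or> vs ! (Suc i mod length vs) = c" if i: "i < length vs" for i
  proof -
    obtain v where "{vs ! i, vs ! (Suc i mod length vs)} = {c, v}"
      using ed[OF i] assms by (auto simp: star_at_def)
    then show ?thesis by (metis doubleton_eq_iff)
  qed
  have ne: "vs ! i \<noteq> vs ! j" if "i < length vs" "j < length vs" "i \<noteq> j" for i j
    using that dist by (simp add: nth_eq_iff_index_eq)
  have lt: "0 < length vs" "1 < length vs" "2 < length vs"
    and md: "Suc 0 mod length vs = 1" "Suc 1 mod length vs = 2"
    using len by auto
  have "vs ! 0 = c \<or> vs ! 1 = c" "vs ! 1 = c \<or> vs ! 2 = c"
    using c[OF lt(1)] c[OF lt(2)] md by simp_all
  then have 1: "vs ! 1 = c" using ne[OF lt(1) lt(3)] by auto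
  \<comment> \<open>The successor of index 2 is 3, or 0 in a triangle, so the edge leaving index 2
    misses \<open>c\<close>.\<close>
  have "Suc 2 mod length vs \<noteq> 1" "Suc 2 mod length vs < length vs"
    using len by (cases "length vs = 3"; simp)+
  then show False using c[OF lt(3)] 1 ne[OF lt(2,3)] ne[of "Suc 2 mod length vs" 1] lt(2) by auto
qed

lemma star_at_connected:
  assumes "star_at H c"
  shows "connected_graph H"
proof -
  let ?R = "{(x, y). {x, y} \<in> edges H}"
  have "(u, c) \<in> ?R\<^sup>*" "(c, u) \<in> ?R\<^sup>*" if "u \<in> verts H" for u
  proof -
    have "u = c \<or> {u, c} \<in> edges H" "u = c \<or> {c, u} \<in> edges H"
      using that assms by (auto simp: star_at_def insert_commute)
    then show "(u, c) \<in> ?R\<^sup>*" "(c, u) \<in> ?R\<^sup>*" by auto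
  qed
  then have "\<forall>u\<in>verts H. \<forall>v\<in>verts H. (u, v) \<in> ?R\<^sup>*"
    using rtrancl_trans by meson
  then show ?thesis using assms by (auto simp: connected_graph_def star_at_def)
qed

lemma star_at_is_star:
  assumes "star_at H c"
  shows "is_star H"
proof -
  have fin: "finite (verts H)" and c: "c \<in> verts H"
    and ed: "edges H = (\<lambda>v. {c, v}) ` (verts H - {c})"
    using assms by (auto simp: star_at_def)
  consider "verts H = {c}" | d where "d \<noteq> c" "verts H = {c, d}" | "card (verts H) \<ge> 3"
  proof -
    have "card (verts H) = 1 \<or> card (verts H) = 2 \<or> card (verts H) \<ge> 3"
      using star_at_card_pos[OF assms] by auto
    then show ?thesis
    proof (elim disjE)
      assume "card (verts H) = 2"
      then obtain x y where "verts H = {x, y}" "x \<noteq> y" by (auto simp: card_2_iff)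
      then show ?thesis using that(2)[of x] that(2)[of y] c by (auto simp: insert_commute)
    qed (use that c in \<open>auto simp: card_1_singleton_iff\<close>)
  qed
  then show ?thesis
  proof cases
    case 1
    then show ?thesis using ed by (auto simp: is_star_def)
  next
    case 2
    then have "verts H - {c} = {d}" by auto
    then have "c \<noteq> d \<and> verts H = {c, d} \<and> edges H = {{c, d}}" using 2 ed by simp
    then show ?thesis unfolding is_star_def by blast
  next
    case 3
    have "is_tree H"
      using star_at_connected[OF assms] star_at_acyclic[OF assms] by (auto simp: is_tree_def)
    moreover have "degree H c \<ge> 2" using star_at_degree_center[OF assms] 3 by simp
    moreover have "\<forall>v\<in>verts H - {c}. degree H v = 1"
      using star_at_degree_satellite[OF assms] by auto
    ultimately show ?thesis using c unfolding is_star_def by blast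
  qed
qed

text \<open>Converse of \<open>star_at_is_star\<close> for subgraphs of \<open>G\<close>. In the
  tree case a satellite not joined to \<open>c\<close> would share its only edge with another vertex
  of degree 1, and these two would form a component without \<open>c\<close>.\<close>

lemma star_in_star_at:
  assumes G: "simple_graph G" and "star_in G H"
  obtains c where "star_at H c"
proof -
  have sub: "verts H \<subseteq> verts G" "edges H \<subseteq> edges G" "\<forall>e\<in>edges H. e \<subseteq> verts H" and "is_star H"
    using assms(2) by (auto simp: star_in_def subgraph_def)
  have fin: "finite (verts H)" using G sub(1) by (auto simp: simple_graph_def intro: finite_subset)
  have pair: "\<exists>a b. a \<noteq> b \<and> a \<in> verts H \<and> b \<in> verts H \<and> e = {a, b}" if "e \<in> edges H" for e
  proof -
    have "\<exists>a b. a \<noteq> b \<and> e = {a, b}" using that sub(2) G unfolding simple_graph_def by blast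
    then show ?thesis using sub(3) that by blast
  qed
  consider v where "verts H = {v}" "edges H = {}"
    | u v where "u \<noteq> v" "verts H = {u, v}" "edges H = {{u, v}}"
    | c where "is_tree H" "c \<in> verts H" "degree H c \<ge> 2" "\<forall>v\<in>verts H - {c}. degree H v = 1"
    using \<open>is_star H\<close> unfolding is_star_def by blast
  then show thesis
  proof cases
    case (1 v)
    then show thesis by (intro that[of v]) (auto simp: star_at_def)
  next
    case (2 u v)
    then have "verts H - {u} = {v}" by auto
    then show thesis using 2 by (intro that[of u]) (simp add: star_at_def)
  next
    case (3 c)
    have sat: "{e \<in> edges H. v \<in> e} = {{c, v}}" if v: "v \<in> verts H" "v \<noteq> c" for v
    proof -
      have uniq: "\<exists>e. e \<in> edges H \<and> x \<in> e \<and> (\<forall>f\<in>edges H. x \<in> f \<longrightarrow> f = e)"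
        if "x \<in> verts H" "x \<noteq> c" for x
      proof -
        have "card {e \<in> edges H. x \<in> e} = 1" using 3(4) that by (simp add: degree_def)
        then obtain e where "{e \<in> edges H. x \<in> e} = {e}" by (rule card_1_singletonE)
        then show ?thesis by (intro exI[of _ e]) blast
      qed
      obtain e where e: "e \<in> edges H" "v \<in> e" "\<And>f. f \<in> edges H \<Longrightarrow> v \<in> f \<Longrightarrow> f = e"
        using uniq[OF v] by blast
      obtain a b where ab: "a \<noteq> b" "a \<in> verts H" "b \<in> verts H" "e = {a, b}"
        using pair[OF e(1)] by blast
      define u where "u = (if v = a then b else a)"
      have u: "u \<noteq> v" "u \<in> verts H" "e = {u, v}"
        using ab e(2) by (auto simp: u_def)
      have "u = c"
      proof (rule ccontr)
        assume "u \<noteq> c"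
        then obtain e' where e': "\<And>f. f \<in> edges H \<Longrightarrow> u \<in> f \<Longrightarrow> f = e'"
          using uniq[OF u(2)] by blast
        \<comment> \<open>Neither end of \<open>e\<close> has another edge, so no path leaves
          \<open>{u, v}\<close>, although the tree connects \<open>v\<close> to
          \<open>c\<close>.\<close>
        have "e = e'" using e'[OF e(1)] u(3) by blast
        then have closed: "y \<in> {u, v}" if "{x, y} \<in> edges H" "x \<in> {u, v}" for x y
          using that e(3)[of "{x, y}"] e'[of "{x, y}"] u(3) by blast
        have "(v, c) \<in> {(x, y). {x, y} \<in> edges H}\<^sup>*"
          using 3 v by (auto simp: is_tree_def connected_graph_def)
        then have "c \<in> {u, v}"
        proof (induction rule: rtrancl_induct)
          case (step y z)
          then show ?case using closed[of y z] by blast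
        qed simp
        then show False using \<open>u \<noteq> c\<close> v by blast
      qed
      then show ?thesis using e u(3) by blast
    qed
    have "edges H = (\<lambda>v. {c, v}) ` (verts H - {c})"
    proof
      show "edges H \<subseteq> (\<lambda>v. {c, v}) ` (verts H - {c})"
      proof
        fix e assume e: "e \<in> edges H"
        then obtain a b where "a \<noteq> b" "a \<in> verts H" "b \<in> verts H" "e = {a, b}" using pair by blast
        then obtain v where "v \<in> verts H" "v \<noteq> c" "v \<in> e" by auto
        then show "e \<in> (\<lambda>v. {c, v}) ` (verts H - {c})" using sat[of v] e by auto
      qed
      show "(\<lambda>v. {c, v}) ` (verts H - {c}) \<subseteq> edges H" using sat by auto
    qed
    then show thesis using 3 fin by (intro that[of c]) (auto simp: star_at_def)
  qed
qed

lemma star_at_star_in: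
  assumes "star_at H c" "verts H \<subseteq> verts G" "\<And>v. v \<in> verts H - {c} \<Longrightarrow> {c, v} \<in> edges G"
  shows "star_in G H"
  using assms star_at_is_star[OF assms(1)] by (auto simp: star_in_def subgraph_def star_at_def)

lemma star_at_edge:
  assumes "star_at H c" "star_in G H" "v \<in> verts H" "v \<noteq> c"
  shows "{c, v} \<in> edges G"
  using assms by (auto simp: star_in_def subgraph_def star_at_def)

section \<open>Adding and removing a satellite\<close>

lemma star_at_attach:
  assumes "star_at H c" "v \<notin> verts H"
  shows "star_at (attach H c v) c" "card (verts (attach H c v)) = Suc (card (verts H))"
  using assms by (auto simp: star_at_def attach_def)

lemma star_in_attach:
  assumes "star_in G H" "star_at H c" "v \<notin> verts H" "v \<in> verts G" "{c, v} \<in> edges G"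
  shows "star_in G (attach H c v)"
proof (rule star_at_star_in)
  show "star_at (attach H c v) c" using assms by (simp add: star_at_attach)
  show "verts (attach H c v) \<subseteq> verts G" using assms by (auto simp: attach_def star_in_def subgraph_def)
  show "{c, u} \<in> edges G" if "u \<in> verts (attach H c v) - {c}" for u
    using that assms star_at_edge[OF assms(2,1)] by (auto simp: attach_def)
qed

lemma star_at_detach:
  assumes "star_at H c" "v \<in> verts H" "v \<noteq> c"
  shows "star_at (detach H c v) c" "card (verts (detach H c v)) = card (verts H) - 1"
  using assms by (auto simp: star_at_def detach_def doubleton_eq_iff)

lemma star_in_detach:
  assumes "star_in G H" "star_at H c" "v \<in> verts H" "v \<noteq> c"
  shows "star_in G (detach H c v)"
proof (rule star_at_star_in)
  show "star_at (detach H c v) c" using assms by (simp add: star_at_detach)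
  show "verts (detach H c v) \<subseteq> verts G" using assms by (auto simp: detach_def star_in_def subgraph_def)
  show "{c, u} \<in> edges G" if "u \<in> verts (detach H c v) - {c}" for u
    using that star_at_edge[OF assms(2,1)] by (auto simp: detach_def)
qed

section \<open>Star partitions\<close>

lemma star_partition_disjoint:
  "star_partition k G P \<Longrightarrow> S \<in> P \<Longrightarrow> T \<in> P \<Longrightarrow> x \<in> verts S \<Longrightarrow> x \<in> verts T \<Longrightarrow> S = T"
  unfolding star_partition_def by blast

lemma star_partition_star_in: "star_partition k G P \<Longrightarrow> S \<in> P \<Longrightarrow> star_in G S"
  unfolding star_partition_def by blast

lemma star_partition_star_at:
  assumes "simple_graph G" "star_partition k G P" "S \<in> P"
  obtains c where "star_at S c"
  using star_in_star_at[OF assms(1) star_partition_star_in[OF assms(2,3)]] by metis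

lemma star_partition_center:
  assumes "simple_graph G" "star_partition k G P" "S \<in> P" "is_center S c"
  shows "star_at S c"
  using star_partition_star_at[OF assms(1-3)] is_center_star_at assms(4) by metis

lemma star_partition_size:
  assumes "simple_graph G" "star_partition k G P" "S \<in> P"
  shows "finite (verts S)" "1 \<le> card (verts S)" "card (verts S) \<le> k" "verts S \<subseteq> verts G"
proof -
  obtain c where "star_at S c" using star_partition_star_at[OF assms] .
  then show "finite (verts S)" "1 \<le> card (verts S)"
    using star_at_card_pos[of S c] by (simp_all add: star_at_def)
  show "card (verts S) \<le> k" "verts S \<subseteq> verts G" using assms by (auto simp: star_partition_def)
qed

text \<open>Stars are nonempty and disjoint, so each is determined by its vertex set, and
  \<open>verts G\<close> has finitely many subsets.\<close>

lemma star_partition_finite: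
  assumes "simple_graph G" "star_partition k G P"
  shows "finite P"
proof (rule inj_on_finite)
  show "inj_on verts P"
  proof (rule inj_onI)
    fix S T assume "S \<in> P" "T \<in> P" "verts S = verts T"
    moreover obtain x where "x \<in> verts S"
      using star_partition_size(2)[OF assms \<open>S \<in> P\<close>] by fastforce
    ultimately show "S = T" using star_partition_disjoint[OF assms(2)] by metis
  qed
  show "verts ` P \<subseteq> Pow (verts G)" using assms(2) unfolding star_partition_def by blast
  show "finite (Pow (verts G))" using assms(1) by (auto simp: simple_graph_def)
qed

lemma star_partition_sum:
  fixes f :: "'a \<Rightarrow> 'b :: comm_monoid_add"
  assumes "simple_graph G" "star_partition k G P"
  shows "(\<Sum>v\<in>verts G. f v) = (\<Sum>S\<in>P. \<Sum>v\<in>verts S. f v)"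
proof -
  have "verts G = (\<Union>S\<in>P. verts S)" using assms(2) by (simp add: star_partition_def)
  then show ?thesis
    using assms star_partition_size(1)[OF assms] star_partition_finite[OF assms]
    by (simp only:) (subst sum.UNION_disjoint; auto simp: star_partition_def)
qed

text \<open>Common frame for all exchanges: the stars in \<open>R\<close> are rebuilt into stars
  \<open>N\<close> on the same vertices. As the new stars have at least two vertices, no singleton
  arises.\<close>

lemma star_partition_replace:
  assumes P: "star_partition k G P" and R: "R \<subseteq> P"
    and N: "\<And>S. S \<in> N \<Longrightarrow> star_in G S \<and> 2 \<le> card (verts S) \<and> card (verts S) \<le> k"
    and disj: "\<And>S T x. S \<in> N \<Longrightarrow> T \<in> N \<Longrightarrow> x \<in> verts S \<Longrightarrow> x \<in> verts T \<Longrightarrow> S = T"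
    and un: "(\<Union>S\<in>N. verts S) = (\<Union>S\<in>R. verts S)"
  shows "star_partition k G ((P - R) \<union> N)"
    "stars_of_size 1 ((P - R) \<union> N) = stars_of_size 1 P - R"
proof -
  have "S = T" if ST: "S \<in> (P - R) \<union> N" "T \<in> (P - R) \<union> N" and x: "x \<in> verts S" "x \<in> verts T" for S T x
  proof -
    have no: False if a: "S \<in> P - R" "T \<in> N" "x \<in> verts S" "x \<in> verts T" for S T
    proof -
      obtain U where U: "U \<in> R" "x \<in> verts U" using a(2,4) un by blast
      then have "S = U" using star_partition_disjoint[OF P, of S U x] a(1,3) R by blast
      then show False using U a(1) by blast
    qed
    consider "S \<in> P - R" "T \<in> P - R" | "S \<in> P - R" "T \<in> N" | "S \<in> N" "T \<in> P - R" | "S \<in> N" "T \<in> N"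
      using ST by blast
    then show ?thesis
    proof cases
      case 1
      then show ?thesis using star_partition_disjoint[OF P _ _ x] by simp
    next
      case 2
      then show ?thesis using no[OF _ _ x] by simp
    next
      case 3
      then show ?thesis using no[OF _ _ x(2,1)] by simp
    next
      case 4
      then show ?thesis using disj[OF _ _ x] by simp
    qed
  qed
  then have "\<forall>S\<in>(P - R) \<union> N. \<forall>T\<in>(P - R) \<union> N. S \<noteq> T \<longrightarrow> verts S \<inter> verts T = {}" by blast
  moreover have "(\<Union>S\<in>(P - R) \<union> N. verts S) = verts G"
  proof -
    have "(\<Union>S\<in>(P - R) \<union> N. verts S) = (\<Union>S\<in>P. verts S)" using un R by blast
    then show ?thesis using P by (simp add: star_partition_def)
  qed
  moreover have "\<forall>S\<in>(P - R) \<union> N. star_in G S \<and> card (verts S) \<le> k"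
    using P N by (auto simp: star_partition_def)
  ultimately show "star_partition k G ((P - R) \<union> N)"
    by (simp add: star_partition_def)
  show "stars_of_size 1 ((P - R) \<union> N) = stars_of_size 1 P - R"
    using N by (fastforce simp: stars_of_size_def)
qed

section \<open>The operations\<close>

lemma simple_graph_edge:
  assumes "simple_graph G" "{u, v} \<in> edges G"
  shows "u \<in> verts G" "v \<in> verts G" "u \<noteq> v"
proof -
  obtain a b where "a \<in> verts G" "b \<in> verts G" "a \<noteq> b" "{u, v} = {a, b}"
    using assms unfolding simple_graph_def by blast
  then show "u \<in> verts G" "v \<in> verts G" "u \<noteq> v" by (auto simp: doubleton_eq_iff)
qed

lemma critical_star_at:
  assumes "simple_graph G" "star_partition k G P" "critical P x" "T \<in> P" "x \<in> verts T"
  shows "star_at T x" "card (verts T) = 2 \<or> card (verts T) = 3"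
proof -
  obtain S where S: "S \<in> P" "card (verts S) = 2 \<and> x \<in> verts S \<or> card (verts S) = 3 \<and> is_center S x"
    using assms(3) unfolding critical_def by blast
  then have "x \<in> verts S" by (auto simp: is_center_def)
  then have "S = T" using star_partition_disjoint[OF assms(2) S(1) assms(4)] assms(5) by blast
  obtain c where c: "star_at T c" using star_partition_star_at[OF assms(1,2,4)] .
  show "card (verts T) = 2 \<or> card (verts T) = 3" using S(2) \<open>S = T\<close> by blast
  show "star_at T x"
    using S(2) \<open>S = T\<close> star_at_small[OF c] is_center_star_at[OF c] assms(5) by auto
qed

lemma critical_ex_star:
  assumes "critical P x"
  obtains T where "T \<in> P" "x \<in> verts T"
  using assms unfolding critical_def is_center_def by blast

text \<open>The star of \<open>u\<close> grows from 2 to 3 vertices, and the star of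
  \<open>c\<close> keeps at least 3.\<close>

lemma operation1_invariant:
  assumes G: "simple_graph G" and k: "k \<ge> 4" and P: "star_partition k G P" and op: "operation1 G P P'"
  shows "star_partition k G P' \<and> stars_of_size 1 P' \<subseteq> stars_of_size 1 P"
proof -
  obtain U T u c v where U: "U \<in> P" "card (verts U) = 2" "u \<in> verts U"
    and T: "T \<in> P" "card (verts T) \<ge> 4" "is_center T c" "v \<in> verts T - {c}"
    and e: "{u, v} \<in> edges G" and P': "P' = (P - {U, T}) \<union> {attach U u v, detach T c v}"
    using op unfolding operation1_def by blast
  obtain d where "star_at U d" using star_partition_star_at[OF G P U(1)] .
  then have Uu: "star_at U u" using star_at_small[of U d u] U by simp
  have Tc: "star_at T c" using star_partition_center[OF G P T(1,3)] .
  have "U \<noteq> T" using U T by auto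
  then have disj: "verts U \<inter> verts T = {}" using star_partition_disjoint[OF P U(1) T(1)] by blast
  have vU: "v \<notin> verts U" using T(4) disj by blast
  have 1: "star_in G (attach U u v)" "card (verts (attach U u v)) = 3"
    using star_in_attach[OF star_partition_star_in[OF P U(1)] Uu vU simple_graph_edge(2)[OF G e] e]
      star_at_attach(2)[OF Uu vU] U(2) by auto
  have 2: "star_in G (detach T c v)" "card (verts (detach T c v)) = card (verts T) - 1"
    using star_in_detach[OF star_partition_star_in[OF P T(1)] Tc] star_at_detach(2)[OF Tc] T(4) by auto
  have N: "star_in G S \<and> 2 \<le> card (verts S) \<and> card (verts S) \<le> k"
    if "S \<in> {attach U u v, detach T c v}" for S
    using that 1 2 k T(2) star_partition_size(3)[OF G P T(1)] by auto
  have D: "S = S'" if "S \<in> {attach U u v, detach T c v}" "S' \<in> {attach U u v, detach T c v}"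
    "x \<in> verts S" "x \<in> verts S'" for S S' x
    using that disj by (auto simp: attach_def detach_def)
  have Un: "(\<Union>S\<in>{attach U u v, detach T c v}. verts S) = (\<Union>S\<in>{U, T}. verts S)"
    using T(4) by (auto simp: attach_def detach_def)
  have R: "{U, T} \<subseteq> P" using U T by blast
  show ?thesis using star_partition_replace[OF P R N D Un] unfolding P' by simp
qed

text \<open>A critical vertex is a center of a star of size 2 or 3, and separateness lets each such
  star grow by one vertex only, so the new stars have at most 4 vertices.\<close>

lemma operation2_invariant:
  assumes G: "simple_graph G" and k: "k \<ge> 4" and P: "star_partition k G P" and op: "operation2 G P P'"
  shows "star_partition k G P' \<and> stars_of_size 1 P' \<subseteq> stars_of_size 1 P"
proof -
  obtain S w where S: "S \<in> P"
    and w: "\<And>v. v \<in> verts S \<Longrightarrow> critical P (w v) \<and> w v \<notin> verts S \<and> {v, w v} \<in> edges G"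
    and sep: "\<And>v v'. v \<in> verts S \<Longrightarrow> v' \<in> verts S \<Longrightarrow> v \<noteq> v' \<Longrightarrow> separate P (w v) (w v')"
    and P': "P' = (P - {S} - {T \<in> P. \<exists>v\<in>verts S. w v \<in> verts T})
             \<union> {attach T (w v) v | T v. T \<in> P \<and> v \<in> verts S \<and> w v \<in> verts T}"
    using op unfolding operation2_def by blast
  define N where "N = {attach T (w v) v | T v. T \<in> P \<and> v \<in> verts S \<and> w v \<in> verts T}"
  define R where "R = insert S {T \<in> P. \<exists>v\<in>verts S. w v \<in> verts T}"
  have P'': "P' = (P - R) \<union> N" unfolding P' N_def R_def by blast
  have notin: "x \<notin> verts T" if "T \<in> P" "v \<in> verts S" "w v \<in> verts T" "x \<in> verts S" for T v x
    using star_partition_disjoint[OF P that(1) S, of x] w[OF that(2)] that(3,4) by metis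
  have N: "star_in G S' \<and> 2 \<le> card (verts S') \<and> card (verts S') \<le> k" if "S' \<in> N" for S'
  proof -
    obtain T v where T: "S' = attach T (w v) v" "T \<in> P" "v \<in> verts S" "w v \<in> verts T"
      using \<open>S' \<in> N\<close> unfolding N_def by blast
    have e: "{w v, v} \<in> edges G" using w[OF T(3)] by (simp add: insert_commute)
    have cr: "star_at T (w v)" "card (verts T) = 2 \<or> card (verts T) = 3"
      using critical_star_at[OF G P _ T(2,4)] w[OF T(3)] by auto
    have "v \<notin> verts T" using notin T by blast
    then show ?thesis
      using star_in_attach[OF star_partition_star_in[OF P T(2)] cr(1) _ simple_graph_edge(2)[OF G e] e]
        star_at_attach(2)[OF cr(1)] cr(2) k T(1) by auto
  qed
  have D: "X = Y" if XY: "X \<in> N" "Y \<in> N" "x \<in> verts X" "x \<in> verts Y" for X Y x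
  proof -
    obtain T v where T: "X = attach T (w v) v" "T \<in> P" "v \<in> verts S" "w v \<in> verts T"
      using \<open>X \<in> N\<close> unfolding N_def by blast
    obtain T' v' where T': "Y = attach T' (w v') v'" "T' \<in> P" "v' \<in> verts S" "w v' \<in> verts T'"
      using \<open>Y \<in> N\<close> unfolding N_def by blast
    show ?thesis
    proof (cases "v = v'")
      case True
      then show ?thesis using T T' star_partition_disjoint[OF P T(2) T'(2)] by blast
    next
      case False
      then obtain A B where AB: "A \<in> P" "B \<in> P" "A \<noteq> B" "w v \<in> verts A" "w v' \<in> verts B"
        using sep[OF T(3) T'(3)] unfolding separate_def by blast
      then have "A = T" "B = T'"
        using star_partition_disjoint[OF P] T T' by blast+
      then have "verts T \<inter> verts T' = {}"
        using star_partition_disjoint[OF P T(2) T'(2)] AB(3) by blast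
      moreover have "v \<notin> verts T'" "v' \<notin> verts T" using notin T T' by blast+
      ultimately show ?thesis using XY(3,4) T(1) T'(1) False by (auto simp: attach_def)
    qed
  qed
  have Un: "(\<Union>S\<in>N. verts S) = (\<Union>S\<in>R. verts S)"
  proof
    show "(\<Union>S\<in>N. verts S) \<subseteq> (\<Union>S\<in>R. verts S)"
      unfolding N_def R_def by (auto simp: attach_def)
    show "(\<Union>S\<in>R. verts S) \<subseteq> (\<Union>S\<in>N. verts S)"
    proof
      fix x assume "x \<in> (\<Union>S\<in>R. verts S)"
      then consider "x \<in> verts S" | T v where "T \<in> P" "v \<in> verts S" "w v \<in> verts T" "x \<in> verts T"
        unfolding R_def by blast
      then show "x \<in> (\<Union>S\<in>N. verts S)"
      proof cases
        case 1
        then obtain T where "T \<in> P" "w x \<in> verts T" using w critical_ex_star by metis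
        then have "attach T (w x) x \<in> N" "x \<in> verts (attach T (w x) x)"
          using 1 by (auto simp: N_def attach_def)
        then show ?thesis by blast
      next
        case 2
        then have "attach T (w v) v \<in> N" "x \<in> verts (attach T (w v) v)"
          by (auto simp: N_def attach_def)
        then show ?thesis by blast
      qed
    qed
  qed
  have R: "R \<subseteq> P" using S unfolding R_def by blast
  show ?thesis using star_partition_replace[OF P R N D Un] unfolding P'' by simp
qed

text \<open>The merged star has 4 vertices if \<open>S\<close> has 2, and 5 if \<open>S\<close> has
  3 and \<open>k \<ge> 5\<close>. For \<open>k = 4\<close> and three vertices, giving up
  \<open>vj\<close> keeps it at 4, and the star of the critical \<open>w3\<close> grows to at most
  4.\<close>

lemma operation3_invariant:
  assumes G: "simple_graph G" and k: "k \<ge> 4" and P: "star_partition k G P" and op: "operation3 k G P P'"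
  shows "star_partition k G P' \<and> stars_of_size 1 P' \<subseteq> stars_of_size 1 P"
proof -
  obtain S W v1 w1 w2 where S: "S \<in> P" "card (verts S) \<in> {2, 3}" "is_center S v1"
    and W: "W \<in> P" "W \<noteq> S" "card (verts W) = 2" "verts W = {w1, w2}"
    and e1: "{w1, v1} \<in> edges G" and e2: "{w2, v1} \<in> edges G"
    and step: "if k \<ge> 5 \<or> card (verts S) = 2
         then P' = (P - {S, W}) \<union> {attach (attach S v1 w1) v1 w2}
         else \<exists>T\<in>P. \<exists>w3\<in>verts T. \<exists>vj\<in>verts S - {v1}.
           critical P w3 \<and> w3 \<notin> verts S \<union> verts W \<and> {w3, vj} \<in> edges G \<and>
           P' = (P - {S, W, T}) \<union> {attach (attach (detach S v1 vj) v1 w1) v1 w2, attach T w3 vj}"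
    using op unfolding operation3_def by blast
  have w12: "w1 \<noteq> w2" using W(3,4) by auto
  have SW: "verts S \<inter> verts W = {}" using star_partition_disjoint[OF P S(1) W(1)] W(2) by blast
  have Sv: "star_at S v1" using star_partition_center[OF G P S(1,3)] .
  have e1': "{v1, w1} \<in> edges G" and e2': "{v1, w2} \<in> edges G" using e1 e2 by (auto simp: insert_commute)
  \<comment> \<open>Stated for a general \<open>H\<close> because one branch attaches to
    \<open>S\<close> and the other to \<open>detach S v1 vj\<close>.\<close>
  have two: "star_in G (attach (attach H v1 w1) v1 w2)"
    "card (verts (attach (attach H v1 w1) v1 w2)) = card (verts H) + 2"
    if H: "star_in G H" "star_at H v1" "verts H \<subseteq> verts S" for H
  proof -
    have w1: "w1 \<notin> verts H" using SW W(4) H(3) by blast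
    have w2: "w2 \<notin> verts (attach H v1 w1)" using SW W(4) H(3) w12 by (auto simp: attach_def)
    note a = star_at_attach[OF H(2) w1]
    have in1: "star_in G (attach H v1 w1)"
      using star_in_attach[OF H(1,2) w1 simple_graph_edge(2)[OF G e1'] e1'] .
    show "star_in G (attach (attach H v1 w1) v1 w2)"
      using star_in_attach[OF in1 a(1) w2 simple_graph_edge(2)[OF G e2'] e2'] .
    show "card (verts (attach (attach H v1 w1) v1 w2)) = card (verts H) + 2"
      using star_at_attach(2)[OF a(1) w2] a(2) by simp
  qed
  show ?thesis
  proof (cases "k \<ge> 5 \<or> card (verts S) = 2")
    case True
    let ?A = "attach (attach S v1 w1) v1 w2"
    have P': "P' = (P - {S, W}) \<union> {?A}" using step True by simp
    have N: "star_in G H \<and> 2 \<le> card (verts H) \<and> card (verts H) \<le> k" if "H \<in> {?A}" for H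
      using that two[OF star_partition_star_in[OF P S(1)] Sv] S(2) True k by auto
    have Un: "(\<Union>S\<in>{?A}. verts S) = (\<Union>S\<in>{S, W}. verts S)"
      using W(4) by (auto simp: attach_def)
    have R: "{S, W} \<subseteq> P" using S W by blast
    show ?thesis using star_partition_replace[OF P R N _ Un] unfolding P' by simp
  next
    case False
    then obtain T w3 vj where T: "T \<in> P" "w3 \<in> verts T" and vj: "vj \<in> verts S - {v1}"
      and w3: "critical P w3" "w3 \<notin> verts S \<union> verts W" "{w3, vj} \<in> edges G"
      and P': "P' = (P - {S, W, T}) \<union> {attach (attach (detach S v1 vj) v1 w1) v1 w2, attach T w3 vj}"
      using step by (simp only: if_False) blast
    let ?A = "attach (attach (detach S v1 vj) v1 w1) v1 w2" and ?B = "attach T w3 vj"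
    have vj': "vj \<in> verts S" "vj \<noteq> v1" using vj by auto
    have TS: "verts T \<inter> verts S = {}" and TW: "verts T \<inter> verts W = {}"
      using star_partition_disjoint[OF P T(1) S(1)] star_partition_disjoint[OF P T(1) W(1)] T(2) w3(2)
      by blast+
    note d = star_at_detach[OF Sv vj'] star_in_detach[OF star_partition_star_in[OF P S(1)] Sv vj']
    have dS: "verts (detach S v1 vj) \<subseteq> verts S" by (auto simp: detach_def)
    have A: "star_in G ?A" "card (verts ?A) = card (verts S) - 1 + 2"
      using two[OF d(3,1) dS] d(2) by simp_all
    have vjT: "vj \<notin> verts T" using TS vj' by blast
    note c = critical_star_at[OF G P w3(1) T]
    have B: "star_in G ?B" "card (verts ?B) = card (verts T) + 1"
      using star_in_attach[OF star_partition_star_in[OF P T(1)] c(1) vjT simple_graph_edge(2)[OF G w3(3)] w3(3)]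
        star_at_attach(2)[OF c(1) vjT] by simp_all
    have N: "star_in G H \<and> 2 \<le> card (verts H) \<and> card (verts H) \<le> k" if "H \<in> {?A, ?B}" for H
      using that A B c(2) S(2) k by auto
    have D: "X = Y" if "X \<in> {?A, ?B}" "Y \<in> {?A, ?B}" "x \<in> verts X" "x \<in> verts Y" for X Y x
      using that TS TW SW vj' W(4) by (auto simp: attach_def detach_def)
    have Un: "(\<Union>S\<in>{?A, ?B}. verts S) = (\<Union>S\<in>{S, W, T}. verts S)"
      using W(4) vj' by (auto simp: attach_def detach_def)
    have R: "{S, W, T} \<subseteq> P" using S W T by blast
    show ?thesis using star_partition_replace[OF P R N D Un] unfolding P' by simp
  qed
qed

section \<open>Singletons of the returned partition\<close>

text \<open>No operation creates a singleton, so the number of the initial partition, already the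
  least possible, is never exceeded.\<close>

lemma approx1_returns_min_singletons:
  assumes G: "simple_graph G" and k: "k \<ge> 4" and ret: "approx1_returns k G P"
  shows "min_singletons k G P"
proof -
  obtain P0 where P0: "min_singletons k G P0" and steps: "(approx1_step k G)\<^sup>*\<^sup>* P0 P"
    using ret unfolding approx1_returns_def by blast
  from steps have *: "star_partition k G P \<and> stars_of_size 1 P \<subseteq> stars_of_size 1 P0"
  proof (induction rule: rtranclp_induct)
    case base
    then show ?case using P0 by (simp add: min_singletons_def)
  next
    case (step P1 P2)
    then have "star_partition k G P2 \<and> stars_of_size 1 P2 \<subseteq> stars_of_size 1 P1"
      using operation1_invariant[OF G k] operation2_invariant[OF G k] operation3_invariant[OF G k]
      unfolding approx1_step_def by blast
    then show ?case using step by blast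
  qed
  have "finite (stars_of_size 1 P0)"
    using P0 star_partition_finite[OF G] by (auto simp: min_singletons_def stars_of_size_def)
  then have "card (stars_of_size 1 P) \<le> card (stars_of_size 1 P0)" using * card_mono by blast
  then show ?thesis using * P0 unfolding min_singletons_def by (meson order_trans)
qed

text \<open>Otherwise the singleton could be absorbed: \<open>u\<close> joins the star of
  \<open>w\<close> if \<open>w\<close> can be its center; else \<open>w\<close> is a satellite of a
  3-star and moves to \<open>u\<close>, which leaves two 2-stars. Both contradict
  minimality.\<close>

lemma min_singletons_neighbor:
  assumes G: "simple_graph G" and k: "k \<ge> 4" and min: "min_singletons k G P"
    and S: "S \<in> P" "card (verts S) = 1" "u \<in> verts S"
    and T: "T \<in> P" "w \<in> verts T" and e: "{u, w} \<in> edges G"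
  shows "card (verts T) \<ge> 4"
proof (rule ccontr)
  assume "\<not> card (verts T) \<ge> 4"
  then have small: "card (verts T) \<le> 3" by simp
  have P: "star_partition k G P" using min by (simp add: min_singletons_def)
  have Su: "verts S = {u}" using S(2,3) by (metis card_1_singletonE singletonD)
  have "u \<noteq> w" using simple_graph_edge[OF G e] by simp
  then have "S \<noteq> T" using Su T(2) by auto
  then have ST: "verts S \<inter> verts T = {}" using P S(1) T(1) by (simp add: star_partition_def)
  have e': "{w, u} \<in> edges G" using e by (simp add: insert_commute)
  obtain d where "star_at S d" using star_partition_star_at[OF G P S(1)] .
  then have Sc: "star_at S u" using star_at_small[of S d u] S by simp
  obtain c where Tc: "star_at T c" using star_partition_star_at[OF G P T(1)] .
  have uT: "u \<notin> verts T" using ST Su by blast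
  have R: "{S, T} \<subseteq> P" using S T by blast
  have "\<exists>Q. star_partition k G Q \<and> stars_of_size 1 Q = stars_of_size 1 P - {S, T}"
  proof (cases "star_at T w")
    case True
    let ?A = "attach T w u"
    have N: "star_in G H \<and> 2 \<le> card (verts H) \<and> card (verts H) \<le> k" if "H \<in> {?A}" for H
      using that star_in_attach[OF star_partition_star_in[OF P T(1)] True uT simple_graph_edge(2)[OF G e'] e']
        star_at_attach(2)[OF True uT] small k star_partition_size(2)[OF G P T(1)] by auto
    have Un: "(\<Union>S\<in>{?A}. verts S) = (\<Union>S\<in>{S, T}. verts S)"
      using Su by (auto simp: attach_def)
    have D: "X = Y" if "X \<in> {?A}" "Y \<in> {?A}" "x \<in> verts X" "x \<in> verts Y" for X Y x
      using that by simp
    show ?thesis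
      by (intro exI[of _ "(P - {S, T}) \<union> {?A}"] conjI star_partition_replace[OF P R N D Un])
  next
    case False
    then have wc: "w \<noteq> c" using Tc by blast
    have three: "card (verts T) = 3" using False star_at_small[OF Tc _ T(2)] small by linarith
    let ?A = "detach T c w" and ?B = "attach S u w"
    have wS: "w \<notin> verts S" using ST T(2) by blast
    have A: "star_in G ?A" "card (verts ?A) = 2"
      using star_in_detach[OF star_partition_star_in[OF P T(1)] Tc T(2) wc]
        star_at_detach(2)[OF Tc T(2) wc] three by simp_all
    have B: "star_in G ?B" "card (verts ?B) = 2"
      using star_in_attach[OF star_partition_star_in[OF P S(1)] Sc wS simple_graph_edge(2)[OF G e] e]
        star_at_attach(2)[OF Sc wS] S(2) by simp_all
    have N: "star_in G H \<and> 2 \<le> card (verts H) \<and> card (verts H) \<le> k" if "H \<in> {?A, ?B}" for H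
      using that A B k by auto
    have D: "X = Y" if "X \<in> {?A, ?B}" "Y \<in> {?A, ?B}" "x \<in> verts X" "x \<in> verts Y" for X Y x
    proof -
      have "u \<notin> verts ?A" "verts ?B = {w, u}" "w \<notin> verts ?A"
        using uT Su by (simp_all add: attach_def detach_def)
      then have "verts ?A \<inter> verts ?B = {}" by simp
      then show ?thesis using that by blast
    qed
    have Un: "(\<Union>S\<in>{?A, ?B}. verts S) = (\<Union>S\<in>{S, T}. verts S)"
      using T(2) by (auto simp: attach_def detach_def)
    show ?thesis
      by (intro exI[of _ "(P - {S, T}) \<union> {?A, ?B}"] conjI star_partition_replace[OF P R N D Un])
  qed
  then obtain Q where Q: "star_partition k G Q" "stars_of_size 1 Q = stars_of_size 1 P - {S, T}" by blast
  have "finite (stars_of_size 1 P)"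
    using star_partition_finite[OF G P] by (auto simp: stars_of_size_def)
  moreover have "stars_of_size 1 Q \<subset> stars_of_size 1 P"
    using Q(2) S by (auto simp: stars_of_size_def)
  ultimately have "card (stars_of_size 1 Q) < card (stars_of_size 1 P)" by (rule psubset_card_mono)
  then show False using min Q(1) by (auto simp: min_singletons_def not_less[symmetric])
qed

section \<open>Systems of distinct representatives\<close>

text \<open>Greedy choice starting at \<open>i0\<close>: as the fibers of \<open>f\<close> have at most two elements, a choice removes
  at most one element from the other sets, and the set that loses one comes next.\<close>

lemma distinct_representatives:
  fixes N :: "'i \<Rightarrow> 'b set"
  assumes "finite I"
    and "\<And>i. i \<in> I \<Longrightarrow> i \<noteq> i0 \<Longrightarrow> 2 \<le> card (N i)"
    and "i0 \<in> I \<Longrightarrow> N i0 \<noteq> {}"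
    and "\<And>i j. i \<in> I \<Longrightarrow> j \<in> I \<Longrightarrow> i \<noteq> j \<Longrightarrow> N i \<inter> N j = {}"
    and "\<And>a b c. a \<in> (\<Union>i\<in>I. N i) \<Longrightarrow> b \<in> (\<Union>i\<in>I. N i) \<Longrightarrow> c \<in> (\<Union>i\<in>I. N i) \<Longrightarrow>
           f a = f b \<Longrightarrow> f a = f c \<Longrightarrow> a = b \<or> a = c \<or> b = c"
  shows "\<exists>w. (\<forall>i\<in>I. w i \<in> N i) \<and> inj_on (\<lambda>i. f (w i)) I"
  using assms
proof (induction "card I" arbitrary: I N i0)
  case 0
  then show ?case by simp
next
  case (Suc n)
  note fin = Suc.prems(1) and two = Suc.prems(2) and ne = Suc.prems(3)
    and disj = Suc.prems(4) and fib = Suc.prems(5)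
  have "I \<noteq> {}" using Suc.hyps(2) by auto
  \<comment> \<open>The set that may have just one element has to be served first.\<close>
  then obtain j where j: "j \<in> I" "i0 \<in> I \<Longrightarrow> j = i0" by blast
  have "N j \<noteq> {}"
  proof (cases "j = i0")
    case False
    then have "2 \<le> card (N j)" using two j(1) by blast
    then show ?thesis by auto
  qed (use ne j in blast)
  then obtain a where a: "a \<in> N j" by blast
  define N' where "N' i = N i - {b. f b = f a}" for i
  have only: "b = b'"
    if h: "i \<in> I - {j}" "b \<in> N i" "f b = f a" "i' \<in> I - {j}" "b' \<in> N i'" "f b' = f a" for i i' b b'
  proof -
    have ne: "i \<noteq> j" "i' \<noteq> j" and I: "i \<in> I" "i' \<in> I" using h(1,4) by auto
    have "a \<noteq> b" using disj[OF I(1) j(1) ne(1)] a h(2) by auto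
    moreover have "a \<noteq> b'" using disj[OF I(2) j(1) ne(2)] a h(5) by auto
    moreover have "a = b \<or> a = b' \<or> b = b'"
    proof (rule fib)
      show "a \<in> (\<Union>i\<in>I. N i)" "b \<in> (\<Union>i\<in>I. N i)" "b' \<in> (\<Union>i\<in>I. N i)"
        using a j(1) I h(2,5) by blast+
    qed (use h(3,6) in simp_all)
    ultimately show ?thesis by blast
  qed
  obtain i1 where i1: "\<And>i b. i \<in> I - {j} \<Longrightarrow> b \<in> N i \<Longrightarrow> f b = f a \<Longrightarrow> i = i1"
  proof (cases "\<exists>i\<in>I - {j}. \<exists>b\<in>N i. f b = f a")
    case True
    then obtain i b where ib: "i \<in> I - {j}" "b \<in> N i" "f b = f a" by blast
    show thesis
    proof (rule that[of i])
      fix i' b' assume h: "i' \<in> I - {j}" "b' \<in> N i'" "f b' = f a"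
      then have b: "b' = b" using only[OF ib] by simp
      show "i' = i"
      proof (rule ccontr)
        assume "i' \<noteq> i"
        then have "N i' \<inter> N i = {}" using disj[of i' i] ib(1) h(1) by simp
        then show False using ib(2) h(2) b by auto
      qed
    qed
  next
    case False
    \<comment> \<open>No remaining set loses an element, so any index may be the exceptional
      one.\<close>
    then show thesis using that[of i0] by blast
  qed
  have two': "2 \<le> card (N i)" if "i \<in> I - {j}" for i using two[of i] j(2) that by blast
  have 1: "n = card (I - {j})" using Suc.hyps(2) j(1) fin by simp
  have 2: "2 \<le> card (N' i)" if "i \<in> I - {j}" "i \<noteq> i1" for i
  proof -
    have "N' i = N i" using i1[OF that(1)] that(2) by (auto simp: N'_def)
    then show ?thesis using two' that by simp
  qed
  have 3: "N' i1 \<noteq> {}" if "i1 \<in> I - {j}"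
  proof
    assume "N' i1 = {}"
    then have "\<And>b. b \<in> N i1 \<Longrightarrow> f b = f a" by (auto simp: N'_def)
    then have "\<And>b b'. b \<in> N i1 \<Longrightarrow> b' \<in> N i1 \<Longrightarrow> b = b'" using only[OF that _ _ that] by blast
    moreover have "finite (N i1)" using two'[OF that] by (intro card_ge_0_finite) simp
    ultimately have "card (N i1) \<le> 1" by (simp add: card_le_Suc0_iff_eq)
    then show False using two'[OF that] by simp
  qed
  have 4: "N' i \<inter> N' i' = {}" if "i \<in> I - {j}" "i' \<in> I - {j}" "i \<noteq> i'" for i i'
    using disj[of i i'] that by (auto simp: N'_def)
  have 5: "b = c \<or> b = d \<or> c = d"
    if "b \<in> (\<Union>i\<in>I - {j}. N' i)" "c \<in> (\<Union>i\<in>I - {j}. N' i)" "d \<in> (\<Union>i\<in>I - {j}. N' i)"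
      "f b = f c" "f b = f d" for b c d
  proof -
    have sub: "(\<Union>i\<in>I - {j}. N' i) \<subseteq> (\<Union>i\<in>I. N i)" by (auto simp: N'_def)
    show ?thesis
      by (rule fib[OF subsetD[OF sub] subsetD[OF sub] subsetD[OF sub]]) (use that in simp_all)
  qed
  have "\<exists>w. (\<forall>i\<in>I - {j}. w i \<in> N' i) \<and> inj_on (\<lambda>i. f (w i)) (I - {j})"
    by (rule Suc.hyps(1)[where N = N' and ?i0.0 = i1, OF 1 _ 2 3 4 5]) (use fin in simp_all)
  then obtain w where w: "\<And>i. i \<in> I - {j} \<Longrightarrow> w i \<in> N' i" "inj_on (\<lambda>i. f (w i)) (I - {j})" by blast
  have "(w(j := a)) i \<in> N i" if "i \<in> I" for i
    using w(1)[of i] that a by (auto simp: N'_def)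
  moreover have "inj_on (\<lambda>i. f ((w(j := a)) i)) I"
  proof (rule inj_onI)
    fix i i' assume h: "i \<in> I" "i' \<in> I" "f ((w(j := a)) i) = f ((w(j := a)) i')"
    have ne: "f (w i) \<noteq> f a" if "i \<in> I - {j}" for i using w(1)[OF that] by (auto simp: N'_def)
    show "i = i'"
      using h ne[of i] ne[of i'] inj_onD[OF w(2), of i i'] by (auto split: if_splits)
  qed
  ultimately show ?case by blast
qed

section \<open>Local optima\<close>

text \<open>What the counting uses about the returned partition \<open>P\<close>; \<open>Q\<close>
  is any star partition to compare with, later an optimal one.\<close>

locale local_optimum =
  fixes G :: "'a graph" and k :: nat and P Q :: "'a graph set"
  assumes k: "k \<ge> 4"
    and G: "simple_graph G"
    and P: "star_partition k G P"
    and Q: "star_partition k G Q"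
    and no_operation2: "\<nexists>P'. operation2 G P P'"
    and no_operation3: "\<nexists>P'. operation3 k G P P'"
    and singleton_neighbor: "\<And>S T u w. S \<in> P \<Longrightarrow> card (verts S) = 1 \<Longrightarrow> u \<in> verts S \<Longrightarrow>
      T \<in> P \<Longrightarrow> w \<in> verts T \<Longrightarrow> {u, w} \<in> edges G \<Longrightarrow> card (verts T) \<ge> 4"
begin

abbreviation adj :: "'a \<Rightarrow> 'a \<Rightarrow> bool" where
  "adj u v \<equiv> {u, v} \<in> edges G"

text \<open>Well defined on \<open>verts G\<close> since \<open>P\<close> is disjoint and covers it.
  As a map it turns separateness into injectivity.\<close>

definition star_of :: "'a \<Rightarrow> 'a graph" where
  "star_of v = (THE S. S \<in> P \<and> v \<in> verts S)"

abbreviation size_of :: "'a \<Rightarrow> nat" where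
  "size_of v \<equiv> card (verts (star_of v))"

lemma adj_sym: "adj u v \<longleftrightarrow> adj v u"
  by (simp add: insert_commute)

lemma star_of_eq:
  assumes "S \<in> P" "v \<in> verts S"
  shows "star_of v = S"
  unfolding star_of_def using assms star_partition_disjoint[OF P _ assms(1)] by (intro the_equality) blast+

lemma star_of_in:
  assumes "v \<in> verts G"
  shows "star_of v \<in> P" "v \<in> verts (star_of v)"
proof -
  obtain S where "S \<in> P" "v \<in> verts S"
    using assms P unfolding star_partition_def by blast
  then show "star_of v \<in> P" "v \<in> verts (star_of v)" using star_of_eq by auto
qed

lemma in_star_of:
  assumes "v \<in> verts G" "u \<in> verts (star_of v)"
  shows "star_of u = star_of v" "u \<in> verts G"
proof -
  show "star_of u = star_of v" using star_of_eq star_of_in[OF assms(1)] assms(2) by metis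
  show "u \<in> verts G" using assms(2) star_partition_size(4)[OF G P star_of_in(1)[OF assms(1)]] by blast
qed

lemma size_of_pos: "v \<in> verts G \<Longrightarrow> size_of v \<ge> 1"
  using star_partition_size(2)[OF G P star_of_in(1)] by blast

lemma finite_star_of: "v \<in> verts G \<Longrightarrow> finite (verts (star_of v))"
  using star_partition_size(1)[OF G P star_of_in(1)] by blast

lemma critical_in: "critical P v \<Longrightarrow> v \<in> verts G"
proof -
  assume "critical P v"
  then obtain S where "S \<in> P" "v \<in> verts S" by (rule critical_ex_star)
  then show ?thesis using star_partition_size(4)[OF G P] by blast
qed

lemma critical_iff:
  assumes "v \<in> verts G"
  shows "critical P v \<longleftrightarrow> size_of v = 2 \<or> size_of v = 3 \<and> is_center (star_of v) v"
proof
  assume "critical P v"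
  then obtain S where S: "S \<in> P" "card (verts S) = 2 \<and> v \<in> verts S \<or> card (verts S) = 3 \<and> is_center S v"
    unfolding critical_def by blast
  then have "star_of v = S" using star_of_eq[OF S(1)] by (auto simp: is_center_def)
  then show "size_of v = 2 \<or> size_of v = 3 \<and> is_center (star_of v) v" using S(2) by blast
next
  assume "size_of v = 2 \<or> size_of v = 3 \<and> is_center (star_of v) v"
  then show "critical P v" using star_of_in[OF assms] unfolding critical_def by blast
qed

lemma critical_size: "critical P v \<Longrightarrow> size_of v = 2 \<or> size_of v = 3"
  using critical_iff critical_in by blast

lemma center_unique:
  assumes "v \<in> verts G" "size_of v \<ge> 3" "is_center (star_of v) a" "is_center (star_of v) b"
  shows "a = b"
  using star_at_unique[OF star_partition_center[OF G P star_of_in(1)] star_partition_center[OF G P star_of_in(1)]]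
    assms by blast

text \<open>A 2-star has two critical vertices and a 3-star has one, its center. This is the fiber
  condition of \<open>distinct_representatives\<close> for \<open>star_of\<close>.\<close>

lemma critical_fiber:
  assumes "critical P a" "critical P b" "critical P c" "star_of a = star_of b" "star_of a = star_of c"
  shows "a = b \<or> a = c \<or> b = c"
proof -
  have V: "a \<in> verts G" "b \<in> verts G" "c \<in> verts G" using assms critical_in by auto
  have sub: "{a, b, c} \<subseteq> verts (star_of a)"
    using star_of_in(2)[OF V(1)] star_of_in(2)[OF V(2)] star_of_in(2)[OF V(3)] assms by simp
  show ?thesis
  proof (cases "size_of a = 2")
    case True
    have "card {a, b, c} \<le> 2" using card_mono[OF finite_star_of[OF V(1)] sub] True by simp
    then show ?thesis by (auto simp: card_insert_if split: if_splits)
  next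
    case False
    then have "size_of a = 3" using critical_size assms(1) by blast
    then show ?thesis
      using critical_iff[OF V(1)] critical_iff[OF V(2)] assms center_unique[OF V(1)] by simp
  qed
qed

lemma separate_iff:
  assumes "u \<in> verts G" "v \<in> verts G"
  shows "separate P u v \<longleftrightarrow> star_of u \<noteq> star_of v"
  unfolding separate_def using star_of_in[OF assms(1)] star_of_in[OF assms(2)] star_of_eq by metis

text \<open>Operation 2 with pairwise separateness in the form that
  \<open>distinct_representatives\<close> delivers.\<close>

lemma no_operation2':
  assumes "S \<in> P" "card (verts S) \<in> {2, 3, 4}"
    and w: "\<And>v. v \<in> verts S \<Longrightarrow> critical P (w v) \<and> w v \<notin> verts S \<and> adj v (w v)"
    and inj: "inj_on (\<lambda>v. star_of (w v)) (verts S)"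
  shows False
proof -
  have "separate P (w v) (w v')" if "v \<in> verts S" "v' \<in> verts S" "v \<noteq> v'" for v v'
    using separate_iff critical_in w that inj_onD[OF inj] by metis
  then have "\<exists>P'. operation2 G P P'" unfolding operation2_def using assms(1,2) w by blast
  then show False using no_operation2 by blast
qed

text \<open>Operation 3 for a 2-star \<open>S\<close>: either vertex may be taken as its center, and
  the branch does not depend on \<open>k\<close>.\<close>

lemma no_operation3':
  assumes "S \<in> P" "W \<in> P" "W \<noteq> S" "card (verts S) = 2" "card (verts W) = 2" "c \<in> verts S"
    and "\<And>w. w \<in> verts W \<Longrightarrow> adj w c"
  shows False
proof -
  obtain w1 w2 where W: "verts W = {w1, w2}" using assms(5) by (auto simp: card_2_iff)
  obtain d where "star_at S d" using star_partition_star_at[OF G P assms(1)] .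
  then have "is_center S c" using star_at_small[of S d c] star_at_is_center assms(4,6) by auto
  moreover have "adj w1 c" "adj w2 c" using assms(7) W by auto
  ultimately have "operation3 k G P ((P - {S, W}) \<union> {attach (attach S c w1) c w2})"
    unfolding operation3_def using assms(1-5) W
    by (intro bexI[of _ S] bexI[of _ W] exI[of _ c] exI[of _ w1] exI[of _ w2]) simp_all
  then show False using no_operation3 by blast
qed

lemma Q_center:
  assumes "T \<in> Q"
  obtains c where "c \<in> verts T" "\<And>t. t \<in> verts T \<Longrightarrow> t \<noteq> c \<Longrightarrow> adj c t"
proof -
  obtain c where c: "star_at T c" using star_partition_star_at[OF G Q assms] .
  then show thesis
    using that[of c] star_at_edge[OF c star_partition_star_in[OF Q assms]] by (simp add: star_at_def)
qed

lemma Q_finite: "T \<in> Q \<Longrightarrow> finite (verts T)" and Q_verts: "T \<in> Q \<Longrightarrow> t \<in> verts T \<Longrightarrow> t \<in> verts G"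
  using star_partition_size(1,4)[OF G Q] by blast+

section \<open>Mates in 2-stars, and debtors\<close>

definition mate :: "'a \<Rightarrow> 'a" where
  "mate v = (SOME x. x \<noteq> v \<and> verts (star_of v) = {v, x})"

lemma mate:
  assumes "v \<in> verts G" "size_of v = 2"
  shows "mate v \<noteq> v" "verts (star_of v) = {v, mate v}" "mate v \<in> verts G"
    "star_of (mate v) = star_of v" "mate (mate v) = v"
proof -
  have ex: "\<exists>x. x \<noteq> u \<and> verts (star_of u) = {u, x}" if u: "u \<in> verts G" "size_of u = 2" for u
  proof -
    obtain a b where ab: "a \<noteq> b" "verts (star_of u) = {a, b}" using u(2) by (auto simp: card_2_iff)
    then have "u = a \<or> u = b" using star_of_in(2)[OF u(1)] by simp
    then show ?thesis using ab by (auto simp: insert_commute)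
  qed
  have m: "mate u \<noteq> u \<and> verts (star_of u) = {u, mate u}" if "u \<in> verts G" "size_of u = 2" for u
    unfolding mate_def by (rule someI_ex[OF ex[OF that]])
  show 1: "mate v \<noteq> v" and 2: "verts (star_of v) = {v, mate v}" using m[OF assms] by auto
  show 3: "mate v \<in> verts G" and 4: "star_of (mate v) = star_of v"
    using in_star_of[OF assms(1), of "mate v"] 2 by auto
  show "mate (mate v) = v" using m[OF 3] assms(2) 1 2 4 by auto
qed

lemma no_operation2_pair:
  assumes "a \<in> verts G" "size_of a = 2" "critical P u" "critical P w"
    "u \<notin> {a, mate a}" "w \<notin> {a, mate a}" "adj a u" "adj (mate a) w" "star_of u \<noteq> star_of w"
  shows False
proof (rule no_operation2'[of "star_of a" "\<lambda>v. if v = a then u else w"])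
  note m = mate[OF assms(1,2)]
  show "star_of a \<in> P" "size_of a \<in> {2, 3, 4}" using star_of_in(1)[OF assms(1)] assms(2) by auto
  show "critical P (if v = a then u else w) \<and> (if v = a then u else w) \<notin> verts (star_of a) \<and>
      adj v (if v = a then u else w)" if "v \<in> verts (star_of a)" for v
    using that assms m(1) unfolding m(2) by auto
  show "inj_on (\<lambda>v. star_of (if v = a then u else w)) (verts (star_of a))"
    unfolding m(2) using m(1) assms(9) by (auto simp: inj_on_def)
qed

text \<open>The dependent vertices are the debtors: each owes one unit to the star of \<open>Q\<close> containing its mate.\<close>

definition all_pairs :: "'a graph \<Rightarrow> bool" where
  "all_pairs T \<longleftrightarrow> T \<in> Q \<and> card (verts T) = k \<and> (\<forall>v\<in>verts T. size_of v = 2)"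

definition dependent :: "'a \<Rightarrow> bool" where
  "dependent v \<longleftrightarrow> v \<in> verts G \<and> size_of v = 2 \<and> (\<exists>T. all_pairs T \<and> mate v \<in> verts T \<and> v \<notin> verts T)"

text \<open>Two satellites forming a 2-star of \<open>P\<close> would both be adjacent to
  \<open>c\<close> in another 2-star, and Operation 3 would merge the two.\<close>

lemma all_pairs_satellites:
  assumes T: "all_pairs T" "c \<in> verts T" "\<forall>t\<in>verts T. t \<noteq> c \<longrightarrow> adj c t"
    and xy: "x \<in> verts T - {c}" "y \<in> verts T - {c}" "x \<noteq> y"
  shows "star_of x \<noteq> star_of y"
proof
  assume eq: "star_of x = star_of y"
  have V: "x \<in> verts G" "y \<in> verts G" "c \<in> verts G"
    using xy T Q_verts by (auto simp: all_pairs_def)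
  have sz: "size_of x = 2" "size_of y = 2" "size_of c = 2" using T xy by (auto simp: all_pairs_def)
  have W: "verts (star_of x) = {x, y}"
    using mate(2)[OF V(1) sz(1)] star_of_in(2)[OF V(2)] eq xy(3) by auto
  then have "c \<notin> verts (star_of x)" using xy by auto
  then have "star_of x \<noteq> star_of c" using star_of_in(2)[OF V(3)] by auto
  moreover have "adj w c" if "w \<in> verts (star_of x)" for w
    using that W T(3) xy adj_sym[of w c] by auto
  ultimately show False
    using no_operation3'[OF star_of_in(1)[OF V(3)] star_of_in(1)[OF V(1)] _ sz(3) sz(1) star_of_in(2)[OF V(3)]]
    by blast
qed

text \<open>A further critical neighbour \<open>w\<close> would make an operation applicable. Which
  one depends on whether the mate \<open>x\<close> is the center \<open>c\<close> of its star
  \<open>T\<close> in \<open>Q\<close>, and on whether \<open>w\<close> lies in the 2-star of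
  \<open>c\<close>.\<close>

lemma dependent_neighbor:
  assumes y: "dependent y" and w: "critical P w" "adj y w"
  shows "w = mate y"
proof (rule ccontr)
  assume wx: "w \<noteq> mate y"
  define x where "x = mate y"
  obtain T where T: "all_pairs T" "x \<in> verts T" "y \<notin> verts T"
    and yV: "y \<in> verts G" and sy: "size_of y = 2"
    using y unfolding dependent_def x_def by blast
  note m = mate[OF yV sy, folded x_def]
  have TQ: "T \<in> Q" "card (verts T) = k" and sT: "\<And>t. t \<in> verts T \<Longrightarrow> size_of t = 2"
    using T(1) by (auto simp: all_pairs_def)
  have crT: "critical P t" if "t \<in> verts T" for t
    using critical_iff[OF Q_verts[OF TQ(1) that]] sT[OF that] by blast
  obtain c where c: "c \<in> verts T" "\<And>t. t \<in> verts T \<Longrightarrow> t \<noteq> c \<Longrightarrow> adj c t" using Q_center[OF TQ(1)] by blast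
  then have "\<forall>t\<in>verts T. t \<noteq> c \<longrightarrow> adj c t" by blast
  note sat = all_pairs_satellites[OF T(1) c(1) this]
  have wy: "w \<noteq> y" using simple_graph_edge(3)[OF G w(2)] by blast
  have wx: "w \<noteq> x" using wx x_def by simp
  have sx: "size_of x = 2" using sT T(2) by blast
  have xV: "x \<in> verts G" using m(3) .
  have cV: "c \<in> verts G" using c(1) Q_verts TQ(1) by blast
  have yc: "y \<noteq> c" using T(3) c(1) by blast
  have crY: "critical P y" using critical_iff[OF yV] sy by blast
  show False
  proof (cases "x = c")
    case True
    \<comment> \<open>Two satellites lie in different stars, so one of them, \<open>z\<close>,
      avoids the star of \<open>w\<close>. Operation 2 on \<open>{x, y}\<close> then pairs
      \<open>x\<close> with \<open>z\<close> and \<open>y\<close> with \<open>w\<close>.\<close>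
    have "\<not> card (verts T - {c}) \<le> Suc 0" using TQ k c(1) Q_finite by simp
    then obtain z1 z2 where z12: "z1 \<in> verts T - {c}" "z2 \<in> verts T - {c}" "z1 \<noteq> z2"
      using card_le_Suc0_iff_eq[of "verts T - {c}"] Q_finite[OF TQ(1)] by blast
    then obtain z where z: "z \<in> verts T - {c}" "star_of z \<noteq> star_of w" using sat[OF z12] by metis
    have "z \<noteq> y" using z(1) T(3) by blast
    show False
      using no_operation2_pair[OF xV sx crT[of z] w(1)] z \<open>z \<noteq> y\<close> True wy wx c(2)[of z] w(2) m(5) by auto
  next
    case False
    have "verts (star_of x) = {x, y}" using m(2,4) by auto
    then have cx: "star_of c \<noteq> star_of x" using star_of_in(2)[OF cV] yc False by auto
    have adjxc: "adj x c" using c(2)[OF T(2) False] adj_sym by blast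
    show False
    proof (cases "star_of w = star_of c")
      case True
      have sc: "size_of c = 2" using sT c(1) by blast
      have "w \<in> {c, mate c}" using True star_of_in(2)[OF critical_in[OF w(1)]] mate(2)[OF cV sc] by simp
      then consider "w = c" | "w = mate c" by blast
      then show False
      proof cases
        case 1
        \<comment> \<open>Now \<open>c\<close> is adjacent to both \<open>x\<close> and
          \<open>y\<close>, so Operation 3 attaches their 2-star to it.\<close>
        show False
        proof (rule no_operation3'[OF star_of_in(1)[OF cV] star_of_in(1)[OF xV] _ sc sx star_of_in(2)[OF cV]])
          show "star_of x \<noteq> star_of c" using cx by simp
          show "adj v c" if "v \<in> verts (star_of x)" for v
            using that \<open>verts (star_of x) = {x, y}\<close> adjxc w(2) 1 by auto
        qed
      next
        case 2
        \<comment> \<open>As \<open>k \<ge> 4\<close>, there is a satellite \<open>z\<close> other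
          than \<open>x\<close> and \<open>w\<close>. Operation 2 on \<open>{c, w}\<close> pairs
          \<open>c\<close> with \<open>z\<close> and \<open>w\<close> with \<open>y\<close>.\<close>
        have "card (verts T - {c, x, w}) \<ge> k - 3"
          using diff_card_le_card_Diff[of "{c, x, w}" "verts T"] card_insert_le_m1[of 3] TQ(2)
            card_length[of "[c, x, w]"] by simp
        then have "card (verts T - {c, x, w}) > 0" using k by simp
        then obtain z where z: "z \<in> verts T - {c, x, w}" by (metis card_gt_0_iff ex_in_conv)
        have "star_of z \<noteq> star_of y" using sat[of z x] z T(2) False m(4) by auto
        then show False
          using no_operation2_pair[OF cV sc crT[of z] crY] z 2 c(2)[of z] w(2) wy yc adj_sym[of w y] by auto
      qed
    next
      case other: False
      \<comment> \<open>Operation 2 on \<open>{x, y}\<close> pairs \<open>x\<close> with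
        \<open>c\<close> and \<open>y\<close> with \<open>w\<close>.\<close>
      have "c \<notin> {x, mate x}" "w \<notin> {x, mate x}" using False yc wx wy m(5) by auto
      then show False
        using no_operation2_pair[OF xV sx crT[OF c(1)] w(1)] adjxc w(2) other m(5) by auto
    qed
  qed
qed

text \<open>The only possible critical neighbour is the mate, and that lies in a different star of
  \<open>Q\<close>.\<close>

lemma dependent_no_critical_neighbor:
  assumes "dependent y" "T \<in> Q" "y \<in> verts T" "t \<in> verts T" "critical P t"
  shows "\<not> adj y t"
proof
  assume "adj y t"
  then have t: "t = mate y" using dependent_neighbor assms by blast
  obtain T' where T': "all_pairs T'" "mate y \<in> verts T'" "y \<notin> verts T'"
    using assms(1) unfolding dependent_def by blast
  then have "T = T'"
    using star_partition_disjoint[OF Q assms(2), of T' t] assms(4) t by (auto simp: all_pairs_def)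
  then show False using T'(3) assms(3) by blast
qed

lemma neighbor_in_Q:
  assumes "T \<in> Q" "card (verts T) \<ge> 2" "v \<in> verts T"
  obtains t where "t \<in> verts T" "adj v t"
proof -
  obtain c where c: "c \<in> verts T" "\<And>t. t \<in> verts T \<Longrightarrow> t \<noteq> c \<Longrightarrow> adj c t" using Q_center[OF assms(1)] by blast
  show thesis
  proof (cases "v = c")
    case True
    have "verts T \<noteq> {c}" using assms(2) by auto
    then show thesis using that c True by blast
  next
    case False
    then show thesis using that[of c] c assms(3) adj_sym by blast
  qed
qed

text \<open>All vertices of \<open>T\<close> are critical, so a debtor would have a critical
  neighbour in its own star of \<open>Q\<close>. Hence the stars that receive payments owe
  none.\<close>

lemma not_dependent_in_all_pairs:
  assumes "all_pairs T" "y \<in> verts T"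
  shows "\<not> dependent y"
proof
  assume "dependent y"
  have T: "T \<in> Q" "card (verts T) \<ge> 2" using assms(1) k by (auto simp: all_pairs_def)
  obtain t where t: "t \<in> verts T" "adj y t" using neighbor_in_Q[OF T assms(2)] .
  have "critical P t" using critical_iff[OF Q_verts[OF T(1) t(1)]] assms(1) t(1) by (auto simp: all_pairs_def)
  then show False using dependent_no_critical_neighbor[OF \<open>dependent y\<close> T(1) assms(2) t(1)] t(2) by blast
qed

text \<open>Satellites lie in different 2-stars, so every vertex besides \<open>c\<close> and
  \<open>mate c\<close> has its mate outside of \<open>T\<close>.\<close>

lemma all_pairs_card:
  assumes "all_pairs T"
  shows "k - 2 \<le> card {x \<in> verts T. dependent (mate x)}"
proof -
  have TQ: "T \<in> Q" "card (verts T) = k" and sT: "\<And>t. t \<in> verts T \<Longrightarrow> size_of t = 2"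
    using assms by (auto simp: all_pairs_def)
  obtain c where c: "c \<in> verts T" "\<And>t. t \<in> verts T \<Longrightarrow> t \<noteq> c \<Longrightarrow> adj c t" using Q_center[OF TQ(1)] by blast
  then have "\<forall>t\<in>verts T. t \<noteq> c \<longrightarrow> adj c t" by blast
  note sat = all_pairs_satellites[OF assms c(1) this]
  have "dependent (mate x)" if x: "x \<in> verts T - {c, mate c}" for x
  proof -
    have xV: "x \<in> verts G" and sx: "size_of x = 2" and cV: "c \<in> verts G" and sc: "size_of c = 2"
      using x c(1) Q_verts[OF TQ(1)] sT by auto
    note m = mate[OF xV sx]
    have "mate x \<noteq> c" using m(5) x by auto
    then have "mate x \<notin> verts T" using sat[of x "mate x"] x m(1,4) by auto
    then show ?thesis unfolding dependent_def using m sx assms x by auto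
  qed
  then have "verts T - {c, mate c} \<subseteq> {x \<in> verts T. dependent (mate x)}" by blast
  then have "card (verts T - {c, mate c}) \<le> card {x \<in> verts T. dependent (mate x)}"
    using Q_finite[OF TQ(1)] by (intro card_mono) auto
  moreover have "k - 2 \<le> card (verts T - {c, mate c})"
    using diff_card_le_card_Diff[of "{c, mate c}" "verts T"] TQ(2) card_length[of "[c, mate c]"] by simp
  ultimately show ?thesis by linarith
qed

section \<open>Centers of full stars of \<open>Q\<close> with critical satellites\<close>

text \<open>Such a star may contain \<open>k - 1\<close> debtors and still needs
  \<open>k - 2\<close>, whence the share \<open>2 k - 3\<close> in \<open>charge\<close>. Meeting
  \<open>star_of v\<close> only in \<open>v\<close> makes all satellites admissible for Operation 2
  on \<open>star_of v\<close>.\<close>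

definition heavy :: "'a \<Rightarrow> bool" where
  "heavy v \<longleftrightarrow> (\<exists>T\<in>Q. card (verts T) = k \<and> v \<in> verts T \<and>
     (\<forall>t\<in>verts T - {v}. adj v t \<and> critical P t) \<and> verts T \<inter> verts (star_of v) = {v})"

text \<open>With a critical neighbour \<open>w0\<close> for \<open>v0\<close>, Operation 2 would
  apply to \<open>star_of v0\<close>: each heavy vertex chooses a satellite of its star of
  \<open>Q\<close>, and \<open>distinct_representatives\<close>, with \<open>v0\<close> as
  exceptional index, makes the choices separate.\<close>

lemma no_critical_neighbor_if_rest_heavy:
  assumes v0: "v0 \<in> verts G" and sz: "size_of v0 \<in> {3, 4}"
    and hv: "\<forall>v\<in>verts (star_of v0) - {v0}. heavy v"
    and w0: "critical P w0" "w0 \<notin> verts (star_of v0)"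
  shows "\<not> adj v0 w0"
proof
  assume adj0: "adj v0 w0"
  let ?S = "verts (star_of v0)"
  have "\<forall>v\<in>?S - {v0}. \<exists>T. T \<in> Q \<and> card (verts T) = k \<and> v \<in> verts T \<and>
     (\<forall>t\<in>verts T - {v}. adj v t \<and> critical P t) \<and> verts T \<inter> ?S = {v}"
    using hv in_star_of(1)[OF v0] unfolding heavy_def by (metis Diff_iff)
  then obtain T where T: "\<And>v. v \<in> ?S - {v0} \<Longrightarrow> T v \<in> Q \<and> card (verts (T v)) = k \<and> v \<in> verts (T v) \<and>
     (\<forall>t\<in>verts (T v) - {v}. adj v t \<and> critical P t) \<and> verts (T v) \<inter> ?S = {v}"
    using bchoice[of "?S - {v0}"] by metis
  define N where "N v = (if v = v0 then {w0} else verts (T v) - {v, w0})" for v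
  have N: "critical P t \<and> t \<notin> ?S \<and> adj v t" if v: "v \<in> ?S" and t: "t \<in> N v" for v t
  proof (cases "v = v0")
    case True
    then show ?thesis using t w0 adj0 by (simp add: N_def)
  next
    case False
    then have "t \<in> verts (T v) - {v}" using t by (simp add: N_def)
    then show ?thesis using T[of v] v False by blast
  qed
  have "\<exists>w. (\<forall>v\<in>?S. w v \<in> N v) \<and> inj_on (\<lambda>v. star_of (w v)) ?S"
  proof (rule distinct_representatives[of _ v0])
    show "finite ?S" using finite_star_of[OF v0] .
    show "2 \<le> card (N v)" if "v \<in> ?S" "v \<noteq> v0" for v
    proof -
      have "card (verts (T v)) = k" using T that by blast
      then show ?thesis
        using diff_card_le_card_Diff[of "{v, w0}" "verts (T v)"] card_length[of "[v, w0]"] k that(2)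
        by (simp add: N_def)
    qed
    show "N v0 \<noteq> {}" by (simp add: N_def)
    show "N v \<inter> N v' = {}" if vv: "v \<in> ?S" "v' \<in> ?S" "v \<noteq> v'" for v v'
    proof (cases "v = v0 \<or> v' = v0")
      case True
      then show ?thesis using vv by (auto simp: N_def)
    next
      case False
      then have TT: "T v \<in> Q" "T v' \<in> Q" "v \<in> verts (T v)" "verts (T v') \<inter> ?S = {v'}"
        using T[of v] T[of v'] vv by blast+
      have "T v \<noteq> T v'"
      proof
        assume "T v = T v'"
        then have "v \<in> verts (T v') \<inter> ?S" using TT(3) vv(1) by simp
        then show False using TT(4) vv(3) by simp
      qed
      then have "verts (T v) \<inter> verts (T v') = {}" using TT(1,2) Q unfolding star_partition_def by blast
      then show ?thesis using False by (auto simp: N_def)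
    qed
    show "a = b \<or> a = c \<or> b = c"
      if "a \<in> (\<Union>v\<in>?S. N v)" "b \<in> (\<Union>v\<in>?S. N v)" "c \<in> (\<Union>v\<in>?S. N v)"
        "star_of a = star_of b" "star_of a = star_of c" for a b c
    proof -
      have "critical P a" "critical P b" "critical P c" using that(1-3) N by blast+
      then show ?thesis using critical_fiber that(4,5) by blast
    qed
  qed
  then obtain w where w: "\<And>v. v \<in> ?S \<Longrightarrow> w v \<in> N v" "inj_on (\<lambda>v. star_of (w v)) ?S" by blast
  have "size_of v0 \<in> {2, 3, 4}" using sz by auto
  moreover have "critical P (w v) \<and> w v \<notin> ?S \<and> adj v (w v)" if "v \<in> ?S" for v
    using N[OF that w(1)[OF that]] .
  ultimately show False using no_operation2'[OF star_of_in(1)[OF v0] _ _ w(2)] by blast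
qed

lemma heavy_critical_neighbor:
  assumes "heavy v"
  obtains w where "critical P w" "w \<notin> verts (star_of v)" "adj v w"
proof -
  obtain T where T: "T \<in> Q" "card (verts T) = k" "v \<in> verts T"
     "\<forall>t\<in>verts T - {v}. adj v t \<and> critical P t" "verts T \<inter> verts (star_of v) = {v}"
    using assms unfolding heavy_def by blast
  have "verts T \<noteq> {v}" using T(2) k by auto
  then obtain t where "t \<in> verts T - {v}" using T(3) by blast
  then show thesis using that[of t] T(4,5) by blast
qed

text \<open>Heaviness of the last vertex would supply the outside critical neighbour just
  excluded.\<close>

lemma not_all_heavy:
  assumes "v \<in> verts G" "size_of v \<in> {3, 4}" "\<forall>u\<in>verts (star_of v) - {v}. heavy u"
  shows "\<not> heavy v"
proof
  assume "heavy v"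
  then obtain w where "critical P w" "w \<notin> verts (star_of v)" "adj v w"
    by (rule heavy_critical_neighbor)
  then show False using no_critical_neighbor_if_rest_heavy[OF assms] by simp
qed

text \<open>The value \<open>-1\<close> occurs at a center whose satellites are both heavy: these take
  \<open>2 (2k - 3) = m + 1\<close>, one unit more than the 3-star owns.\<close>

definition charge :: "'a \<Rightarrow> int" where
  "charge v =
    (if size_of v = 1 then 0
     else if size_of v = 2 then of_bool (dependent (mate v)) - of_bool (dependent v)
     else if size_of v = 3 then
       (if is_center (star_of v) v
        then (if \<forall>u\<in>verts (star_of v) - {v}. heavy u then -1 else int k - 2)
        else (if heavy v then 2 * int k - 3 else int k - 2))
     else if size_of v = 4 then
       (if heavy v then 2 * int k - 3
        else if \<forall>u\<in>verts (star_of v) - {v}. heavy u then 2 * int k - 5 else 2 * int k - 4)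
     else 2 * int k - 3)"

section \<open>Charge handed out by the stars of \<open>P\<close>\<close>

text \<open>A 3-star spends exactly \<open>m = 4 k - 7\<close> if one or both satellites are heavy.
  A 4-star spends exactly \<open>2 m\<close> with two or three heavy vertices, and cannot have four.
  Payments inside a 2-star cancel, and the extra term lifts the bound for a singleton from
  \<open>- m\<close> to 0.\<close>

lemma charge_star:
  assumes S: "S \<in> P"
  shows "(\<Sum>v\<in>verts S. charge v) \<le>
    (4 * int k - 7) * (int (card (verts S)) - 2) + (if card (verts S) = 1 then 4 * int k - 7 else 0)"
proof -
  have st: "star_of v = S" if "v \<in> verts S" for v using star_of_eq[OF S that] .
  have VG: "v \<in> verts G" if "v \<in> verts S" for v using star_partition_size(4)[OF G P S] that by blast
  have pos: "1 \<le> card (verts S)" using star_partition_size(2)[OF G P S] .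
  have k': "int k \<ge> 4" using k by simp
  consider "card (verts S) = 1" | "card (verts S) = 2" | "card (verts S) = 3" | "card (verts S) = 4"
    | "card (verts S) \<ge> 5"
    using pos by linarith
  then show ?thesis
  proof cases
    case 1
    then have "charge v = 0" if "v \<in> verts S" for v using st[OF that] by (simp add: charge_def)
    then show ?thesis using 1 by simp
  next
    case 2
    then obtain a where a: "a \<in> verts S" by fastforce
    have sa: "size_of a = 2" using st[OF a] 2 by simp
    note m = mate[OF VG[OF a] sa]
    have S2: "verts S = {a, mate a}" using m(2) st[OF a] by simp
    have "charge a = of_bool (dependent (mate a)) - of_bool (dependent a)"
      "charge (mate a) = of_bool (dependent a) - of_bool (dependent (mate a))"
      using sa m(4,5) by (simp_all add: charge_def)
    then show ?thesis using 2 m(1) by (simp add: S2)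
  next
    case 3
    obtain c where c: "star_at S c" using star_partition_star_at[OF G P S] .
    have cS: "c \<in> verts S" using c by (simp add: star_at_def)
    have "card (verts S - {c}) = 2" using 3 cS c by (simp add: star_at_def)
    then obtain a b where ab: "a \<noteq> b" "verts S - {c} = {a, b}" by (auto simp: card_2_iff)
    then have S3: "verts S = {c, a, b}" "c \<noteq> a" "c \<noteq> b" using cS by auto
    have cen: "is_center S v \<longleftrightarrow> v = c" for v
    proof
      assume "is_center S v"
      then show "v = c" using star_at_unique[OF is_center_star_at[OF c] c] 3 by simp
    qed (use star_at_is_center[OF c] in simp)
    have sa: "star_of a = S" "star_of b = S" "star_of c = S" using st S3(1) by auto
    have "charge c = (if heavy a \<and> heavy b then -1 else int k - 2)"
      "charge a = (if heavy a then 2 * int k - 3 else int k - 2)"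
      "charge b = (if heavy b then 2 * int k - 3 else int k - 2)"
      using sa 3 cen S3(2,3) ab(2) by (simp_all add: charge_def)
    moreover have "(\<Sum>v\<in>verts S. charge v) = charge c + charge a + charge b"
      unfolding S3(1) using S3(2,3) ab(1) by simp
    ultimately show ?thesis using 3 k' by (simp split: if_splits)
  next
    case 4
    have fin: "finite (verts S)" using star_partition_size(1)[OF G P S] .
    obtain a where a: "a \<in> verts S" using 4 by fastforce
    then have "card (verts S - {a}) = 3" using 4 fin by simp
    then obtain b c d where bcd: "verts S - {a} = {b, c, d}" "b \<noteq> c" "b \<noteq> d" "c \<noteq> d"
      by (auto simp: card_3_iff)
    then have S4: "verts S = {a, b, c, d}" "a \<noteq> b" "a \<noteq> c" "a \<noteq> d" using a by auto
    have sa: "star_of a = S" "star_of b = S" "star_of c = S" "star_of d = S" using st S4(1) by auto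
    have rest: "verts S - {b} = {a, c, d}" "verts S - {c} = {a, b, d}" "verts S - {d} = {a, b, c}"
      using S4 bcd by auto
    have ch: "charge a = (if heavy a then 2 * int k - 3 else if heavy b \<and> heavy c \<and> heavy d then 2 * int k - 5 else 2 * int k - 4)"
      "charge b = (if heavy b then 2 * int k - 3 else if heavy a \<and> heavy c \<and> heavy d then 2 * int k - 5 else 2 * int k - 4)"
      "charge c = (if heavy c then 2 * int k - 3 else if heavy a \<and> heavy b \<and> heavy d then 2 * int k - 5 else 2 * int k - 4)"
      "charge d = (if heavy d then 2 * int k - 3 else if heavy a \<and> heavy b \<and> heavy c then 2 * int k - 5 else 2 * int k - 4)"
      using 4 by (simp_all add: charge_def sa rest bcd(1))
    have "\<not> (heavy a \<and> heavy b \<and> heavy c \<and> heavy d)"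
      using not_all_heavy[OF VG[OF a]] 4 by (auto simp: sa bcd(1))
    moreover have "(\<Sum>v\<in>verts S. charge v) = charge a + charge b + charge c + charge d"
      unfolding S4(1) using S4(2-4) bcd(2-4) by simp
    ultimately show ?thesis
      unfolding ch using 4 by (cases "heavy a"; cases "heavy b"; cases "heavy c"; cases "heavy d"; simp)
  next
    case 5
    have "(\<Sum>v\<in>verts S. charge v) = (\<Sum>v\<in>verts S. 2 * int k - 3)"
      using st 5 by (intro sum.cong) (auto simp: charge_def)
    then have sum: "(\<Sum>v\<in>verts S. charge v) = int (card (verts S)) * (2 * int k - 3)" by simp
    \<comment> \<open>With \<open>j\<close> vertices this product bounds the term \<open>k j\<close>
      from below and leaves a slack of at least \<open>4 j - 18\<close>, positive for
      \<open>j \<ge> 5\<close>.\<close>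
    have "0 \<le> (int k - 4) * (int (card (verts S)) - 4)" using k' 5 by simp
    then show ?thesis unfolding sum using 5 by (simp add: algebra_simps)
  qed
qed

section \<open>Charge collected by the stars of \<open>Q\<close>\<close>

lemma charge_ge: "charge v \<ge> -1"
  using k by (auto simp: charge_def)

text \<open>Only debtors and centers of 3-stars with two heavy satellites can be negative. The star
  of the latter has no other critical vertex, and outside of it
  \<open>no_critical_neighbor_if_rest_heavy\<close> applies.\<close>

lemma charge_negD:
  assumes v: "v \<in> verts G" and neg: "charge v < 0"
  shows "critical P v"
    and "\<And>T t. T \<in> Q \<Longrightarrow> v \<in> verts T \<Longrightarrow> t \<in> verts T \<Longrightarrow> critical P t \<Longrightarrow> \<not> adj v t"
proof -
  have "size_of v = 2 \<and> dependent v \<or>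
      size_of v = 3 \<and> is_center (star_of v) v \<and> (\<forall>u\<in>verts (star_of v) - {v}. heavy u)"
    using neg k by (auto simp: charge_def split: if_splits)
  then consider "size_of v = 2" "dependent v"
    | "size_of v = 3" "is_center (star_of v) v" "\<forall>u\<in>verts (star_of v) - {v}. heavy u"
    by blast
  note cs = this
  show crit: "critical P v" using critical_iff[OF v] cs by metis
  show "\<not> adj v t" if t: "T \<in> Q" "v \<in> verts T" "t \<in> verts T" "critical P t" for T t
  proof (cases rule: cs)
    case 1
    then show ?thesis using dependent_no_critical_neighbor t by blast
  next
    case 2
    show ?thesis
    proof (cases "t \<in> verts (star_of v)")
      case True
      then have "star_of t = star_of v" using in_star_of(1)[OF v] by blast
      then have "is_center (star_of v) t"
        using critical_iff[OF critical_in[OF t(4)]] t(4) 2(1) by simp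
      then have "t = v" using center_unique[OF v] 2 by simp
      then show ?thesis using simple_graph_edge(3)[OF G] by blast
    next
      case False
      then show ?thesis using no_critical_neighbor_if_rest_heavy[OF v _ 2(3) t(4)] 2(1) by simp
    qed
  qed
qed

lemma singleton_adj:
  assumes "u \<in> verts G" "w \<in> verts G" "size_of u = 1" "adj u w"
  shows "size_of w \<ge> 4"
  using singleton_neighbor[OF star_of_in(1)[OF assms(1)] assms(3) star_of_in(2)[OF assms(1)] star_of_in[OF assms(2)] assms(4)] .

lemma charge_noncritical:
  assumes "v \<in> verts G" "\<not> critical P v" "size_of v \<noteq> 1"
  shows "charge v \<ge> int k - 2"
  using assms k critical_iff[OF assms(1)] by (auto simp: charge_def)

text \<open>\<open>B\<close> holds the few vertices whose charge is counted exactly; elsewhere each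
  negative vertex costs at most one unit.\<close>

lemma sum_charge_ge:
  assumes T: "T \<in> Q" and B: "B \<subseteq> verts T" and n: "card {v \<in> verts T - B. charge v < 0} \<le> n"
  shows "(\<Sum>v\<in>B. charge v) - int n \<le> (\<Sum>v\<in>verts T. charge v)"
proof -
  have fin: "finite (verts T)" using Q_finite[OF T] .
  have "(\<Sum>v\<in>verts T. charge v) = (\<Sum>v\<in>B. charge v) + (\<Sum>v\<in>verts T - B. charge v)"
    using sum.subset_diff[OF B fin, of charge] by simp
  moreover have "(\<Sum>v\<in>verts T - B. - of_bool (charge v < 0)) \<le> (\<Sum>v\<in>verts T - B. charge v)"
    using charge_ge by (intro sum_mono) auto
  moreover have "(\<Sum>v\<in>verts T - B. - of_bool (charge v < 0) :: int) = - int (card {v \<in> verts T - B. charge v < 0})"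
    using fin by (simp add: sum_negf sum_of_bool_eq Int_def)
  ultimately show ?thesis using n by linarith
qed

text \<open>Cases by where negative charge occurs. A negative vertex has no critical neighbour in
  \<open>T\<close>, so negative charge at one end of an edge of \<open>T\<close> forces a large
  charge at the other end.\<close>

lemma charge_full:
  assumes T: "T \<in> Q" and cT: "card (verts T) = k"
  shows "int k - 2 \<le> (\<Sum>v\<in>verts T. charge v)"
proof -
  have fin: "finite (verts T)" using Q_finite[OF T] .
  have V: "t \<in> verts G" if "t \<in> verts T" for t using Q_verts[OF T that] .
  obtain c where c: "c \<in> verts T" and adjc: "\<And>t. t \<in> verts T \<Longrightarrow> t \<noteq> c \<Longrightarrow> adj c t"
    using Q_center[OF T] by blast
  have small: "card {v \<in> verts T - B. charge v < 0} \<le> k - j"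
    if "B \<subseteq> verts T" "card B = j" for B j
  proof -
    have "card {v \<in> verts T - B. charge v < 0} \<le> card (verts T - B)"
      using fin by (intro card_mono) auto
    also have "\<dots> = k - j" using that cT finite_subset[OF that(1) fin] by (simp add: card_Diff_subset)
    finally show ?thesis .
  qed
  consider (none) "\<And>v. v \<in> verts T \<Longrightarrow> charge v \<ge> 0" | (center) "charge c < 0"
    | (sat) y where "y \<in> verts T" "y \<noteq> c" "charge y < 0" "charge c \<ge> 0"
    by (metis not_le)
  then show ?thesis
  proof cases
    case none
    show ?thesis
    proof (cases "all_pairs T")
      case True
      \<comment> \<open>No vertex of \<open>T\<close> owes anything, so the total counts the
        received payments.\<close>
      have "(\<Sum>v\<in>verts T. charge v) = (\<Sum>v\<in>verts T. of_bool (dependent (mate v)))"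
        using True not_dependent_in_all_pairs[OF True]
        by (intro sum.cong) (auto simp: charge_def all_pairs_def)
      also have "\<dots> = int (card {x \<in> verts T. dependent (mate x)})"
        using fin by (simp add: sum_of_bool_eq Int_def)
      finally show ?thesis using all_pairs_card[OF True] by simp
    next
      case False
      then obtain v where v: "v \<in> verts T" "size_of v \<noteq> 2" using T cT by (auto simp: all_pairs_def)
      \<comment> \<open>A singleton of \<open>P\<close> has neighbours only in stars with at least 4
        vertices.\<close>
      have "\<exists>u\<in>verts T. size_of u \<ge> 3"
      proof (cases "size_of v = 1")
        case True
        obtain t where t: "t \<in> verts T" "adj v t" using neighbor_in_Q[OF T _ v(1)] cT k by auto
        then have "size_of t \<ge> 4" using singleton_adj[OF V[OF v(1)] V[OF t(1)] True] by blast
        then show ?thesis using t(1) by (intro bexI[of _ t]) simp_all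
      next
        case False
        then have "size_of v \<ge> 3" using v(2) size_of_pos[OF V[OF v(1)]] by linarith
        then show ?thesis using v(1) by blast
      qed
      then obtain u where u: "u \<in> verts T" "size_of u \<ge> 3" by blast
      \<comment> \<open>Nonnegativity rules out the value -1 of a 3-star center.\<close>
      have "charge u \<ge> int k - 2" using none[OF u(1)] u(2) k by (auto simp: charge_def)
      then show ?thesis using member_le_sum[of u "verts T" charge] u(1) none fin by fastforce
    qed
  next
    case center
    note neg = charge_negD[OF V[OF c] center]
    have ge: "charge t \<ge> int k - 2" if t: "t \<in> verts T" "t \<noteq> c" for t
    proof (rule charge_noncritical[OF V[OF t(1)]])
      show "\<not> critical P t" using neg(2)[OF T c t(1)] adjc[OF t] by blast
      show "size_of t \<noteq> 1"
        using singleton_adj[OF V[OF t(1)] V[OF c]] adjc[OF t] adj_sym critical_size[OF neg(1)] by fastforce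
    qed
    \<comment> \<open>Three satellites are enough: \<open>3 (k - 2) - 1 \<ge> k - 2\<close>, the
      unit lost being that of the center.\<close>
    have "card (verts T - {c}) \<ge> 3" using c cT k fin by simp
    then obtain B where B: "B \<subseteq> verts T - {c}" "card B = 3" by (metis obtain_subset_with_card_n)
    have "(\<Sum>v\<in>B. int k - 2) \<le> (\<Sum>v\<in>B. charge v)" using ge B(1) by (intro sum_mono) blast
    then have "3 * (int k - 2) \<le> (\<Sum>v\<in>B. charge v)" using B(2) by simp
    moreover have "card {v \<in> verts T - B. charge v < 0} \<le> 1"
    proof -
      have "{v \<in> verts T - B. charge v < 0} \<subseteq> {c}" using ge k by force
      then show ?thesis using card_mono[of "{c}"] by fastforce
    qed
    ultimately show ?thesis using sum_charge_ge[OF T, of B 1] B(1) k by fastforce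
  next
    case sat
    note neg = charge_negD[OF V[OF sat(1)] sat(3)]
    have adjy: "adj y c" using adjc[OF sat(1,2)] adj_sym by blast
    have ncrit: "\<not> critical P c" using neg(2)[OF T sat(1) c] adjy by blast
    have sc1: "size_of c \<noteq> 1"
      using singleton_adj[OF V[OF c] V[OF sat(1)]] adjc[OF sat(1,2)] critical_size[OF neg(1)] by fastforce
    have gc: "charge c \<ge> int k - 2" using charge_noncritical[OF V[OF c] ncrit sc1] .
    have neg_le: "card {v \<in> verts T - {c}. charge v < 0} \<le> k - 1" using small[of "{c}" 1] c by simp
    show ?thesis
    proof (cases "charge c \<ge> 2 * int k - 3")
      case True
      \<comment> \<open>Even if all satellites are negative,
        \<open>2 k - 3 - (k - 1) = k - 2\<close> remains.\<close>
      then show ?thesis using sum_charge_ge[OF T _ neg_le] c k by simp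
    next
      case light: False
      show ?thesis
      proof (cases "\<exists>t\<in>verts T. t \<noteq> c \<and> charge t \<ge> int k - 2")
        case True
        then obtain t where t: "t \<in> verts T" "t \<noteq> c" "charge t \<ge> int k - 2" by blast
        then have "card {v \<in> verts T - {c, t}. charge v < 0} \<le> k - 2" using small[of "{c, t}" 2] c by simp
        then have "(\<Sum>v\<in>{c, t}. charge v) - int (k - 2) \<le> (\<Sum>v\<in>verts T. charge v)"
          using sum_charge_ge[OF T, of "{c, t}"] c t by simp
        then show ?thesis using t gc k by simp
      next
        case low: False
        then have low': "critical P t \<or> size_of t = 1" if "t \<in> verts T" "t \<noteq> c" for t
          using charge_noncritical[OF V[OF that(1)]] that by blast
        \<comment> \<open>A noncritical center with charge below \<open>2 k - 3\<close> is a
          satellite of a 3-star or lies in a 4-star, and it is not heavy.\<close>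
        have nh: "\<not> heavy c" and sc: "size_of c = 3 \<and> \<not> is_center (star_of c) c \<or> size_of c = 4"
        proof -
          have "size_of c \<noteq> 2" "size_of c = 3 \<Longrightarrow> \<not> is_center (star_of c) c"
            using ncrit critical_iff[OF V[OF c]] by auto
          note c3 = this
          show "size_of c = 3 \<and> \<not> is_center (star_of c) c \<or> size_of c = 4"
            using c3 light sc1 by (cases "size_of c = 3"; cases "size_of c = 4"; simp add: charge_def)
          then show "\<not> heavy c" using light by (auto simp: charge_def)
        qed
        have heavyI: "verts T \<inter> verts (star_of c) \<noteq> {c}" if "\<And>t. t \<in> verts T \<Longrightarrow> t \<noteq> c \<Longrightarrow> critical P t"
          using nh T cT c adjc that unfolding heavy_def by blast
        have cst: "c \<in> verts (star_of c)" using star_of_in(2)[OF V[OF c]] .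
        show ?thesis
        proof (cases "size_of c = 3")
          case True
          have "critical P t" if t: "t \<in> verts T" "t \<noteq> c" for t
          proof -
            have "adj t c" using adjc[OF t] adj_sym by blast
            then have "size_of t \<noteq> 1" using singleton_adj[OF V[OF t(1)] V[OF c]] True by fastforce
            then show ?thesis using low'[OF t] by blast
          qed
          note crit = this
          \<comment> \<open>All satellites are critical but \<open>c\<close> is not heavy, so
            \<open>T\<close> meets the 3-star of \<open>c\<close> again. The critical vertex found
            there is the center of that 3-star, and its charge \<open>k - 2\<close> contradicts
            \<open>low\<close>.\<close>
          then obtain t where t: "t \<in> verts T" "t \<in> verts (star_of c)" "t \<noteq> c"
            using heavyI c cst by blast
          have st: "star_of t = star_of c" using in_star_of(1)[OF V[OF c] t(2)] .
          have "is_center (star_of t) t"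
            using critical_iff[OF V[OF t(1)]] crit[OF t(1,3)] st True by simp
          moreover have "\<not> (\<forall>u\<in>verts (star_of t) - {t}. heavy u)" using nh t(3) cst st by auto
          ultimately have "charge t = int k - 2" unfolding charge_def using True st by simp metis
          then show ?thesis using low t by force
        next
          case False
          then have s4: "size_of c = 4" using sc by blast
          have out: "t \<notin> verts (star_of c)" if "critical P t" for t
            using in_star_of(1)[OF V[OF c], of t] critical_size[OF that] s4 by auto
          \<comment> \<open>The negative satellite \<open>y\<close> is a critical neighbour of
            \<open>c\<close> outside its 4-star.\<close>
          have "\<not> (\<forall>u\<in>verts (star_of c) - {c}. heavy u)"
            using no_critical_neighbor_if_rest_heavy[OF V[OF c] _ _ neg(1) out[OF neg(1)]]
              adjc[OF sat(1,2)] s4 by auto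
          then have ch: "charge c = 2 * int k - 4" using s4 nh by (simp add: charge_def)
          \<comment> \<open>If all satellites were negative, they would be critical and
            \<open>c\<close> would be heavy. So at most \<open>k - 2\<close> are negative, and
            \<open>2 k - 4 - (k - 2) = k - 2\<close> remains.\<close>
          have "\<exists>t\<in>verts T. t \<noteq> c \<and> charge t \<ge> 0"
          proof (rule ccontr)
            assume "\<not> ?thesis"
            then have "critical P t" if "t \<in> verts T" "t \<noteq> c" for t
              using charge_negD(1)[OF V[OF that(1)]] that by force
            then show False using heavyI out c cst by blast
          qed
          then obtain t where t: "t \<in> verts T" "t \<noteq> c" "charge t \<ge> 0" by blast
          then have "card {v \<in> verts T - {c, t}. charge v < 0} \<le> k - 2" using small[of "{c, t}" 2] c by simp
          then have "(\<Sum>v\<in>{c, t}. charge v) - int (k - 2) \<le> (\<Sum>v\<in>verts T. charge v)"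
            using sum_charge_ge[OF T, of "{c, t}"] c t by simp
          then show ?thesis using t ch k by simp
        qed
      qed
    qed
  qed
qed

text \<open>With fewer than \<open>k\<close> vertices the bonus outweighs even a charge of -1 at
  every vertex. The term for singletons matches the one in \<open>charge_star\<close>.\<close>

lemma charge_Q:
  assumes T: "T \<in> Q"
  shows "int k - 2 + (if card (verts T) = 1 then 4 * int k - 7 else 0)
    \<le> (\<Sum>v\<in>verts T. charge v) + (4 * int k - 7) * (int k - int (card (verts T)))"
proof (cases "card (verts T) = k")
  case True
  then show ?thesis using charge_full[OF T True] k by simp
next
  case False
  then have lt: "card (verts T) < k" and pos: "card (verts T) \<ge> 1"
    using star_partition_size(2,3)[OF G Q T] by auto
  have "(\<Sum>v\<in>verts T. - 1) \<le> (\<Sum>v\<in>verts T. charge v)" using charge_ge by (intro sum_mono)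
  then have ge: "- int (card (verts T)) \<le> (\<Sum>v\<in>verts T. charge v)" by simp
  show ?thesis
  proof (cases "card (verts T) = 1")
    case True
    have "4 * int k \<le> int k * int k" using k by (intro mult_right_mono) auto
    moreover have "(4 * int k - 7) * (int k - 1) = 4 * (int k * int k) - 11 * int k + 7"
      by (simp add: algebra_simps)
    ultimately have "int k - 2 + (4 * int k - 7) \<le> - 1 + (4 * int k - 7) * (int k - 1)"
      using k by linarith
    then show ?thesis using True ge by simp
  next
    case False
    have "int k - 2 + int (card (verts T)) \<le> (4 * int k - 7) * 1" using lt k by simp
    also have "\<dots> \<le> (4 * int k - 7) * (int k - int (card (verts T)))"
      using lt k by (intro mult_left_mono) auto
    finally have "int k - 2 + int (card (verts T)) \<le> (4 * int k - 7) * (int k - int (card (verts T)))" .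
    then show ?thesis using False ge by simp
  qed
qed

section \<open>Comparison of the two sums\<close>

text \<open>Summation over \<open>P\<close> bounds the total charge from above, summation over
  \<open>Q\<close> from below. The terms with the number of vertices cancel, and the hypothesis
  absorbs the singleton terms.\<close>

lemma size_bound:
  assumes "card (stars_of_size 1 P) \<le> card (stars_of_size 1 Q)"
  shows "2 * (4 * int k - 7) * int (card P) \<le> (int k * (4 * int k - 7) - (int k - 2)) * int (card Q)"
proof -
  let ?m = "4 * int k - 7" and ?n = "int (card (verts G))"
  have finP: "finite P" and finQ: "finite Q" using star_partition_finite[OF G P] star_partition_finite[OF G Q] .
  have nP: "(\<Sum>S\<in>P. int (card (verts S))) = ?n" and nQ: "(\<Sum>S\<in>Q. int (card (verts S))) = ?n"
    using star_partition_sum[OF G P, of "\<lambda>_. 1 :: int"] star_partition_sum[OF G Q, of "\<lambda>_. 1 :: int"] by simp_all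
  have s: "(\<Sum>S\<in>A. if card (verts S) = 1 then ?m else 0) = ?m * int (card (stars_of_size 1 A))"
    if "finite A" for A :: "'a graph set"
    using that by (simp add: stars_of_size_def sum.If_cases Int_def)
  have "(\<Sum>v\<in>verts G. charge v) = (\<Sum>S\<in>P. \<Sum>v\<in>verts S. charge v)" by (rule star_partition_sum[OF G P])
  also have "\<dots> \<le> (\<Sum>S\<in>P. ?m * (int (card (verts S)) - 2) + (if card (verts S) = 1 then ?m else 0))"
    by (intro sum_mono charge_star)
  also have "\<dots> = ?m * (?n - 2 * int (card P)) + ?m * int (card (stars_of_size 1 P))"
    by (simp add: sum.distrib s[OF finP] sum_distrib_left[symmetric] sum_subtractf nP del: One_nat_def)
  finally have up: "(\<Sum>v\<in>verts G. charge v) \<le> ?m * (?n - 2 * int (card P)) + ?m * int (card (stars_of_size 1 P))" .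
  have "(int k - 2) * int (card Q) + ?m * int (card (stars_of_size 1 Q))
      = (\<Sum>T\<in>Q. int k - 2 + (if card (verts T) = 1 then ?m else 0))"
    by (simp add: sum.distrib s[OF finQ] del: One_nat_def)
  also have "\<dots> \<le> (\<Sum>T\<in>Q. (\<Sum>v\<in>verts T. charge v) + ?m * (int k - int (card (verts T))))"
    by (intro sum_mono charge_Q)
  also have "\<dots> = (\<Sum>v\<in>verts G. charge v) + ?m * (int k * int (card Q) - ?n)"
    by (simp add: sum.distrib star_partition_sum[OF G Q] sum_distrib_left[symmetric] sum_subtractf nQ)
  finally have "(int k - 2) * int (card Q) + ?m * int (card (stars_of_size 1 Q))
      \<le> (\<Sum>v\<in>verts G. charge v) + ?m * (int k * int (card Q) - ?n)" .
  moreover have "?m * int (card (stars_of_size 1 P)) \<le> ?m * int (card (stars_of_size 1 Q))"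
    using assms k by (intro mult_left_mono) auto
  ultimately show ?thesis using up by (simp add: algebra_simps)
qed

end

theorem theorem2:
  fixes G :: "'a graph" and k :: nat and P :: "'a graph set"
  assumes "k \<ge> 4"
    and "simple_graph G"
    and "approx1_returns k G P"
  shows "real (card P) \<le> (2 * real k ^ 2 - 4 * real k + 1) / (4 * real k - 7) * real (opt k G)
    \<and> (2 * real k ^ 2 - 4 * real k + 1) / (4 * real k - 7) * real (opt k G)
      = (real k / 2 - (real k - 2) / (8 * real k - 14)) * real (opt k G)"
proof -
  note k = assms(1) and G = assms(2)
  have min: "min_singletons k G P" using approx1_returns_min_singletons[OF G k assms(3)] .
  then have P: "star_partition k G P" by (simp add: min_singletons_def)
  have "\<exists>n. \<exists>Q. star_partition k G Q \<and> card Q = n" using P by blast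
  then have "\<exists>Q. star_partition k G Q \<and> card Q = opt k G" unfolding opt_def by (rule LeastI_ex)
  then obtain R where R: "star_partition k G R" "card R = opt k G" by blast
  have no: "\<nexists>P'. operation2 G P P'" "\<nexists>P'. operation3 k G P P'"
    using assms(3) unfolding approx1_returns_def approx1_step_def by blast+
  interpret local_optimum G k P R
    using k G P R(1) no min_singletons_neighbor[OF G k min] by unfold_locales
  have "card (stars_of_size 1 P) \<le> card (stars_of_size 1 R)" using min R(1) by (simp add: min_singletons_def)
  then have "2 * (4 * int k - 7) * int (card P) \<le> (int k * (4 * int k - 7) - (int k - 2)) * int (opt k G)"
    using size_bound R(2) by simp
  then have "real_of_int (2 * (4 * int k - 7) * int (card P))
      \<le> real_of_int ((int k * (4 * int k - 7) - (int k - 2)) * int (opt k G))"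
    by (simp only: of_int_le_iff)
  \<comment> \<open>A common factor 2 is cancelled:
    \<open>k (4 k - 7) - (k - 2) = 2 (2 k^2 - 4 k + 1)\<close>.\<close>
  then have "(4 * real k - 7) * real (card P) \<le> (2 * real k ^ 2 - 4 * real k + 1) * real (opt k G)"
    by (simp add: algebra_simps power2_eq_square)
  moreover have pos: "4 * real k - 7 > 0" using k by simp
  ultimately have "real (card P) \<le> (2 * real k ^ 2 - 4 * real k + 1) / (4 * real k - 7) * real (opt k G)"
    by (simp add: pos_le_divide_eq mult.commute)
  moreover have "(2 * real k ^ 2 - 4 * real k + 1) / (4 * real k - 7) = real k / 2 - (real k - 2) / (8 * real k - 14)"
  proof -
    have "8 * real k - 14 = 2 * (4 * real k - 7)" by simp
    then show ?thesis using pos by (simp add: field_simps power2_eq_square)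
  qed
  ultimately show ?thesis by simp
qed

end
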